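(* Let $\mathcal{K}$ be a finite set of positive integers. Suppose $\alpha_r \in \mathcal{R}$ for $r \in \mathcal{K} \cup \{0\}$, and let \[ P(u) = \sum_{r \in \mathcal{K} \cup \{0\}} \alpha_r u^r \in \mathcal{R}[u]. \] Suppose that for some $k \in \mathcal{K}$: (i) $p \nmid k$; (ii) for every positive integer $v$, $p^v k \notin \mathcal{K}$; (iii) $\alpha_k \notin \mathcal{Q}$. Then the sequence $(P(u) \bmod \mathcal{Z})_{u \in \mathcal{Z}}$ is well-distributed in $\mathcal{T}$.
   Context: Fix a finite field $\mathbb{F}_q$ of characteristic $p$. Let $\mathcal{Z} = \mathbb{F}_q[t]$, $\mathcal{Q} = \mathbb{F}_q(t)$, and $\mathcal{R} = \mathbb{F}_q((t^{-1})) = \{\sum_{n=-\infty}^N c_n t^n : N \in \mathbb{Z}, c_n \in \mathbb{F}_q\}$, the completion of $\mathcal{Q}$ with respect to the absolute value $|u/v| = q^{\deg u - \deg v}$. Let $\mathcal{T} = \mathcal{R}/\mathcal{Z}$, a compact group; each element of $\mathcal{T}$ has a unique representative of the form $\sum_{n=-\infty}^{-1} c_n t^n$. For $M \in \mathbb{N}$ and $a_1, \ldots, a_M \in \mathbb{F}_q$, the cylinder set $C(M; a_1, \ldots, a_M)$ is the set of elements of $\mathcal{T}$ whose representative $\sum_{n \le -1} c_n t^n$ satisfies $c_{-1} = a_1, \ldots, c_{-M} = a_M$. A Følner sequence in $\mathcal{Z}$ is a sequence $(F_N)_{N \in \mathbb{N}}$ of finite nonempty subsets of $\mathcal{Z}$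 such that $|F_N \cap (F_N + u)|/|F_N| \to 1$ as $N \to \infty$ for every $u \in \mathcal{Z}$. A sequence $(a(u))_{u \in \mathcal{Z}}$ in $\mathcal{T}$ is uniformly distributed with respect to a Følner sequence $(F_N)$ if for every $M \in \mathbb{N}$ and $a_1, \ldots, a_M \in \mathbb{F}_q$, $|\{u \in F_N : a(u) \in C(M; a_1, \ldots, a_M)\}|/|F_N| \to q^{-M}$; it is well-distributed if it is uniformly distributed with respect to every Følner sequence in $\mathcal{Z}$. *)

theory Defs
  imports "HOL-Analysis.Analysis" "HOL-Computational_Algebra.Polynomial"
begin

text \<open>Elements of R = F_q((t^-1)) are represented by their coefficient functions
  c :: int => 'a (c n is the coefficient of t^n) whose support is bounded above.\<close>

definition laurent :: "(int \<Rightarrow> 'a::zero) \<Rightarrow> bool" where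
  "laurent c \<longleftrightarrow> (\<exists>N. \<forall>n>N. c n = 0)"

definition poly_to_R :: "'a::zero poly \<Rightarrow> int \<Rightarrow> 'a" where
  "poly_to_R p n = (if n \<ge> 0 then coeff p (nat n) else 0)"

text \<open>Multiplication in R (Cauchy product; the index set is finite for Laurent series).\<close>
definition lmul :: "(int \<Rightarrow> 'a::comm_ring_1) \<Rightarrow> (int \<Rightarrow> 'a) \<Rightarrow> int \<Rightarrow> 'a" where
  "lmul c d n = (\<Sum>i\<in>{i. c i \<noteq> 0 \<and> d (n - i) \<noteq> 0}. c i * d (n - i))"

definition lone :: "int \<Rightarrow> 'a::comm_ring_1" where
  "lone n = (if n = 0 then 1 else 0)"

primrec lpow :: "(int \<Rightarrow> 'a::comm_ring_1) \<Rightarrow> nat \<Rightarrow> int \<Rightarrow> 'a" where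
  "lpow c 0 = lone"
| "lpow c (Suc m) = lmul c (lpow c m)"

definition in_Q :: "(int \<Rightarrow> 'a::field) \<Rightarrow> bool" where
  "in_Q c \<longleftrightarrow> (\<exists>a b. b \<noteq> 0 \<and> lmul (poly_to_R b) c = poly_to_R a)"

definition evalP :: "nat set \<Rightarrow> (nat \<Rightarrow> int \<Rightarrow> 'a::comm_ring_1) \<Rightarrow> 'a poly \<Rightarrow> int \<Rightarrow> 'a" where
  "evalP K \<alpha> u n = (\<Sum>r\<in>K \<union> {0}. lmul (\<alpha> r) (lpow (poly_to_R u) r) n)"

text \<open>Cylinder set membership: the class of c modulo Z lies in C(M; a_1,...,a_M),
  i.e. the coefficients of t^-1, ..., t^-M of c are a_1, ..., a_M.\<close>
definition in_cylinder :: "(int \<Rightarrow> 'a) \<Rightarrow> nat \<Rightarrow> (nat \<Rightarrow> 'a) \<Rightarrow> bool" where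
  "in_cylinder c M a \<longleftrightarrow> (\<forall>j\<in>{1..M}. c (- int j) = a j)"

definition folner :: "(nat \<Rightarrow> 'a::comm_ring_1 poly set) \<Rightarrow> bool" where
  "folner F \<longleftrightarrow> (\<forall>N. finite (F N) \<and> F N \<noteq> {}) \<and>
     (\<forall>u. (\<lambda>N. real (card (F N \<inter> (\<lambda>x. x + u) ` F N)) / real (card (F N))) \<longlonglongrightarrow> 1)"

definition unif_distributed :: "('a::{comm_ring_1,finite} poly \<Rightarrow> int \<Rightarrow> 'a) \<Rightarrow> (nat \<Rightarrow> 'a poly set) \<Rightarrow> bool" where
  "unif_distributed s F \<longleftrightarrow> (\<forall>M \<ge> 1. \<forall>a :: nat \<Rightarrow> 'a.
     (\<lambda>N. real (card {u\<in>F N. in_cylinder (s u) M a}) / real (card (F N)))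
       \<longlonglongrightarrow> 1 / real (CARD('a)) ^ M)"

definition well_distributed :: "('a::{comm_ring_1,finite} poly \<Rightarrow> int \<Rightarrow> 'a) \<Rightarrow> bool" where
  "well_distributed s \<longleftrightarrow> (\<forall>F. folner F \<longrightarrow> unif_distributed s F)"

end

theory Submission
  imports Defs "HOL-Computational_Algebra.Formal_Laurent_Series"
begin

text \<open>
  Fix a nontrivial additive character \<open>\<kappa>\<close> of \<open>F_q\<close> that is invariant under \<open>x \<mapsto> x^p\<close>, and
  let \<open>\<psi>(x)\<close> be \<open>\<kappa>\<close> of the coefficient of \<open>t^-1\<close>. By Fourier expansion of cylinder sets
  it suffices that the Folner averages of \<open>\<psi>(m P(u))\<close> tend to 0 for all \<open>m \<noteq> 0\<close> in \<open>F_q[t]\<close>.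
  The Cartier operator \<open>C\<close> satisfies \<open>C(x y^p) = C(x) y\<close> for \<open>y\<close> in \<open>F_q[t]\<close> and
  \<open>\<psi>(C x) = \<psi>(x)\<close>, hence \<open>\<psi>(a u^(p^i r)) = \<psi>(C^i(a) u^r)\<close>: for scalar phases only exponents
  \<open>r\<close> prime to \<open>p\<close> matter, with coefficient the sum of \<open>C^i(a)\<close> over the coefficients \<open>a\<close> at
  \<open>p^i r\<close>. The hypotheses on \<open>k\<close> say that the reduced coefficient at \<open>k\<close> is \<open>m \<alpha>_k\<close>, which
  is irrational.

  It remains to treat polynomials with an irrational reduced coefficient, by induction on the
  largest exponent \<open>k\<close> of one. Shifts by multiples \<open>h\<close> of a common denominator \<open>b\<close> make the higher,
  rational terms drop out of differences, so the difference polynomial has degree at most \<open>k - 1\<close>.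
  Write \<open>k - 1 = p^v s\<close> with \<open>s\<close> prime to \<open>p\<close>. For \<open>h = b w y^(p^v)\<close> the reduced
  coefficient of the difference at \<open>s\<close> is a polynomial in \<open>y\<close> whose linear coefficient is
  \<open>C^v(k \<alpha>_k b w)\<close>. For suitable \<open>w\<close> this is irrational, so only finitely many \<open>y\<close> are bad, and
  van der Corput's inequality applied to infinitely many shifts without bad differences
  closes the induction.
\<close>

subsection \<open>The inverse Frobenius map\<close>

lemma prime_CHAR_finite_field: "prime CHAR('a::{field,finite})"
  by (intro prime_CHAR_semidom finite_imp_CHAR_pos) auto

lemma inj_frobenius: "inj (\<lambda>x::'a::{field,finite}. x ^ CHAR('a))"
proof (rule injI)
  fix x y :: 'a
  assume *: "x ^ CHAR('a) = y ^ CHAR('a)"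
  have "x ^ CHAR('a) = ((x - y) + y) ^ CHAR('a)"
    by simp
  also have "\<dots> = (x - y) ^ CHAR('a) + y ^ CHAR('a)"
    by (rule freshmans_dream) (auto simp: prime_CHAR_finite_field)
  finally show "x = y"
    using * by simp
qed

lemma surj_frobenius: "surj (\<lambda>x::'a::{field,finite}. x ^ CHAR('a))"
  by (rule finite_UNIV_inj_surj[OF _ inj_frobenius]) simp

definition frob_root :: "'a::{field,finite} \<Rightarrow> 'a" where
  "frob_root = inv (\<lambda>x. x ^ CHAR('a))"

lemma frob_root_power [simp]: "frob_root x ^ CHAR('a) = (x::'a::{field,finite})"
  unfolding frob_root_def using surj_f_inv_f[OF surj_frobenius] by fast

lemma frob_root_eqI: "y ^ CHAR('a) = x \<Longrightarrow> frob_root x = (y::'a::{field,finite})"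
  unfolding frob_root_def using inv_f_f[OF inj_frobenius[where ?'a = 'a]] by blast

lemma frob_root_0 [simp]: "frob_root 0 = (0::'a::{field,finite})"
  by (rule frob_root_eqI) (simp add: prime_gt_0_nat prime_CHAR_finite_field)

lemma frob_root_eq_0_iff [simp]: "frob_root x = 0 \<longleftrightarrow> (x::'a::{field,finite}) = 0"
  by (metis frob_root_0 frob_root_power power_eq_0_iff)

lemma frob_root_add: "frob_root (x + y) = frob_root x + frob_root (y::'a::{field,finite})"
  by (rule frob_root_eqI, subst freshmans_dream) (auto simp: prime_CHAR_finite_field)

lemma frob_root_mult: "frob_root (x * y) = frob_root x * frob_root (y::'a::{field,finite})"
  by (rule frob_root_eqI) (simp add: power_mult_distrib)

subsection \<open>A Frobenius-invariant additive character\<close>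

definition additive_subgroup :: "'a::comm_ring_1 set \<Rightarrow> bool" where
  "additive_subgroup U \<longleftrightarrow> 0 \<in> U \<and> (\<forall>x\<in>U. \<forall>y\<in>U. x - y \<in> U)"

lemma additive_subgroup_add:
  "additive_subgroup U \<Longrightarrow> x \<in> U \<Longrightarrow> y \<in> U \<Longrightarrow> x + y \<in> U"
  unfolding additive_subgroup_def by (metis diff_0 diff_minus_eq_add)

lemma additive_subgroup_diff:
  "additive_subgroup U \<Longrightarrow> x \<in> U \<Longrightarrow> y \<in> U \<Longrightarrow> x - y \<in> U"
  unfolding additive_subgroup_def by blast

lemma additive_subgroup_of_int_mult:
  assumes "additive_subgroup U" "x \<in> U"
  shows "of_int i * x \<in> U"
proof (induction i rule: int_induct[where k = 0])
  case base
  then show ?case using assms by (simp add: additive_subgroup_def)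
next
  case (step1 i)
  then show ?case using additive_subgroup_add[OF assms(1) step1(2) assms(2)]
    by (simp add: algebra_simps)
next
  case (step2 i)
  then show ?case using additive_subgroup_diff[OF assms(1) step2(2) assms(2)]
    by (simp add: algebra_simps)
qed

text \<open>The kernel of the character is a maximal proper subgroup \<open>U\<close>; its quotient has order \<open>p\<close>.\<close>

lemma character_trivial_on_subgroup:
  fixes W :: "'a::{field,finite} set"
  assumes W: "additive_subgroup W" "W \<noteq> UNIV"
  obtains \<kappa> :: "'a \<Rightarrow> complex" where
    "\<And>x y. \<kappa> (x + y) = \<kappa> x * \<kappa> y" "\<And>x. norm (\<kappa> x) = 1" "\<And>x. x \<in> W \<Longrightarrow> \<kappa> x = 1"
    "\<exists>x. \<kappa> x \<noteq> 1"
proof -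
  define p where "p = CHAR('a)"
  have p: "prime p" unfolding p_def by (rule prime_CHAR_finite_field)
  define \<U> where "\<U> = {U :: 'a set. additive_subgroup U \<and> W \<subseteq> U \<and> U \<noteq> UNIV}"
  have "finite \<U>" "W \<in> \<U>"
    using W by (auto simp: \<U>_def)
  then obtain U where U: "U \<in> \<U>" and max: "\<And>U'. U' \<in> \<U> \<Longrightarrow> U \<subseteq> U' \<Longrightarrow> U = U'"
    using finite_has_maximal[of \<U>] by (metis empty_iff)
  have sub: "additive_subgroup U" and WU: "W \<subseteq> U" and "U \<noteq> UNIV"
    using U by (auto simp: \<U>_def)
  then obtain y where y: "y \<notin> U" by blast
  \<comment> \<open>The subgroup generated by \<open>U\<close> and \<open>y\<close>. By maximality
    of \<open>U\<close> it is everything, so each \<open>v\<close> is an integer multiple of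
    \<open>y\<close> modulo \<open>U\<close>.\<close>
  define V where "V = {v. \<exists>i::int. v - of_int i * y \<in> U}"
  have "additive_subgroup V"
    unfolding additive_subgroup_def
  proof (intro conjI ballI)
    show "0 \<in> V" using sub by (auto simp: V_def additive_subgroup_def intro!: exI[of _ 0])
  next
    fix v w assume "v \<in> V" "w \<in> V"
    then obtain i j :: int where "v - of_int i * y \<in> U" "w - of_int j * y \<in> U"
      by (auto simp: V_def)
    from additive_subgroup_diff[OF sub this] have "(v - w) - of_int (i - j) * y \<in> U"
      by (simp add: algebra_simps)
    then show "v - w \<in> V" unfolding V_def by blast
  qed
  moreover have UV: "U \<subseteq> V" by (auto simp: V_def intro!: exI[of _ 0])
  moreover have "y \<in> V"
    using sub by (auto simp: V_def additive_subgroup_def intro!: exI[of _ 1])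
  ultimately have V: "V = UNIV"
    using max[of V] y WU by (auto simp: \<U>_def)
  define idx where "idx v = (SOME i::int. v - of_int i * y \<in> U)" for v
  have idx: "v - of_int (idx v) * y \<in> U" for v
    using V unfolding idx_def V_def by (metis (mono_tags, lifting) UNIV_I mem_Collect_eq someI_ex)
  \<comment> \<open>Otherwise Bezout, together with \<open>p = 0\<close> in the field, would write
    \<open>y\<close> as an integer multiple of \<open>of_int d * y\<close> and put it into
    \<open>U\<close>.\<close>
  have dvd: "int p dvd d" if d: "of_int d * y \<in> U" for d
  proof (rule ccontr)
    assume "\<not> int p dvd d"
    then have "coprime (int p) d" using p by (simp add: prime_imp_coprime)
    then obtain a b where ab: "a * int p + b * d = 1"
      by (metis bezout_int coprime_imp_gcd_eq_1)
    have "of_int b * (of_int d * y) = of_int (a * int p + b * d) * y"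
      by (simp add: p_def mult.assoc)
    also have "\<dots> = y" by (simp add: ab)
    finally show False using additive_subgroup_of_int_mult[OF sub d, of b] y by metis
  qed
  define \<kappa> where "\<kappa> v = cis (2 * pi * of_int (idx v) / real p)" for v
  \<comment> \<open>\<open>idx\<close> is an arbitrary choice, but two admissible multiples differ
    by a multiple of \<open>p\<close>, so the root of unity does not depend on it.\<close>
  have \<kappa>_eq: "\<kappa> v = cis (2 * pi * of_int i / real p)" if i: "v - of_int i * y \<in> U" for v i
  proof -
    have "of_int (i - idx v) * y \<in> U"
      using additive_subgroup_diff[OF sub idx[of v] i] by (simp add: algebra_simps)
    then obtain m where m: "i - idx v = int p * m" using dvd by (metis dvdE)
    then have i: "i = idx v + int p * m" by simp
    have "2 * pi * of_int i / real p = 2 * pi * of_int (idx v) / real p + 2 * pi * of_int m"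
      using p by (simp add: i field_simps prime_gt_0_nat)
    then show ?thesis
      by (simp add: \<kappa>_def flip: cis_mult)
  qed
  show ?thesis
  proof (rule that[of \<kappa>])
    show "\<kappa> (v + w) = \<kappa> v * \<kappa> w" for v w
    proof -
      have "(v + w) - of_int (idx v + idx w) * y \<in> U"
        using additive_subgroup_add[OF sub idx[of v] idx[of w]] by (simp add: algebra_simps)
      from \<kappa>_eq[OF this] show ?thesis
        by (simp add: \<kappa>_def cis_mult add_divide_distrib ring_distribs)
    qed
    show "norm (\<kappa> v) = 1" for v by (simp add: \<kappa>_def)
    show "\<kappa> x = 1" if "x \<in> W" for x
      using \<kappa>_eq[of x 0] that WU by auto
    have "\<kappa> y = cis (2 * pi / real p)"
      using \<kappa>_eq[of y 1] sub by (simp add: additive_subgroup_def)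
    moreover have "cis (2 * pi / real p) \<noteq> 1"
    proof
      assume "cis (2 * pi / real p) = 1"
      then have "cos (2 * pi / real p) = 1" by (metis cis.sel(1) one_complex.sel(1))
      then obtain n :: int where "2 * pi / real p = of_int n * (2 * pi)"
        by (auto simp: cos_one_2pi_int)
      then have "(2 * pi) * (1 / real p) = (2 * pi) * of_int n" by (simp add: mult.commute)
      then have "1 / real p = of_int n" by (subst (asm) mult_left_cancel) auto
      moreover have "0 < 1 / real p" "1 / real p < 1"
        using prime_gt_1_nat[OF p] by auto
      ultimately show False by (metis of_int_0_less_iff of_int_less_1_iff zless_add1_eq zero_less_one int_one_le_iff_zero_less not_le)
    qed
    ultimately show "\<exists>x. \<kappa> x \<noteq> 1" by metis
  qed
qed

text \<open>Invariance under Frobenius makes the character blind to the \<open>p\<close>-th roots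
  that the Cartier operator takes.\<close>

locale frobenius_character =
  fixes \<kappa> :: "'a::{field,finite} \<Rightarrow> complex"
  assumes \<kappa>_add: "\<kappa> (x + y) = \<kappa> x * \<kappa> y"
    and norm_\<kappa> [simp]: "norm (\<kappa> x) = 1"
    and \<kappa>_frob: "\<kappa> (x ^ CHAR('a)) = \<kappa> x"
    and \<kappa>_nontrivial: "\<exists>x. \<kappa> x \<noteq> 1"

text \<open>Invariance amounts to triviality on all \<open>x^p - x\<close>. These form a subgroup
  since Frobenius is additive, and a proper one since 0 and 1 both give 0: a non-injective self-map
  of a finite set is not onto.\<close>

lemma frobenius_character_exists: "\<exists>\<kappa> :: 'a::{field,finite} \<Rightarrow> complex. frobenius_character \<kappa>"
proof -
  define W where "W = range (\<lambda>x::'a. x ^ CHAR('a) - x)"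
  have pos: "CHAR('a) > 0" by (simp add: prime_gt_0_nat prime_CHAR_finite_field)
  have frob_diff: "(x - y) ^ CHAR('a) = x ^ CHAR('a) - y ^ CHAR('a)" for x y :: 'a
    using freshmans_dream[OF prime_CHAR_finite_field refl, of "x - y" y] by simp
  have "additive_subgroup W"
    unfolding additive_subgroup_def
  proof (intro conjI ballI)
    show "0 \<in> W" unfolding W_def by (rule range_eqI[of _ _ 0]) (use pos in auto)
    fix v w assume "v \<in> W" "w \<in> W"
    then obtain x y where "v = x ^ CHAR('a) - x" "w = y ^ CHAR('a) - y" by (auto simp: W_def)
    then have "v - w = (x - y) ^ CHAR('a) - (x - y)" by (simp add: frob_diff)
    then show "v - w \<in> W" unfolding W_def by blast
  qed
  moreover have "W \<noteq> UNIV"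
  proof
    assume "W = UNIV"
    then have "inj (\<lambda>x::'a. x ^ CHAR('a) - x)"
      unfolding W_def by (intro finite_UNIV_surj_inj) auto
    from injD[OF this, of 0 1] show False using pos by auto
  qed
  ultimately obtain \<kappa> :: "'a \<Rightarrow> complex" where \<kappa>: "\<And>x y. \<kappa> (x + y) = \<kappa> x * \<kappa> y"
    "\<And>x. norm (\<kappa> x) = 1" "\<And>x. x \<in> W \<Longrightarrow> \<kappa> x = 1" "\<exists>x. \<kappa> x \<noteq> 1"
    using character_trivial_on_subgroup by blast
  have "\<kappa> (x ^ CHAR('a)) = \<kappa> x" for x
    using \<kappa>(1)[of "x ^ CHAR('a) - x" x] \<kappa>(3)[of "x ^ CHAR('a) - x"] by (simp add: W_def)
  with \<kappa> show ?thesis unfolding frobenius_character_def by blast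
qed

context frobenius_character
begin

lemma \<kappa>_nonzero [simp]: "\<kappa> x \<noteq> 0"
  by (metis norm_\<kappa> norm_zero zero_neq_one)

lemma \<kappa>_0 [simp]: "\<kappa> 0 = 1"
  using \<kappa>_add[of 0 0] by simp

lemma \<kappa>_minus: "\<kappa> (- x) = cnj (\<kappa> x)"
proof -
  have "\<kappa> (- x) * \<kappa> x = cnj (\<kappa> x) * \<kappa> x"
    using \<kappa>_add[of "- x" x] complex_norm_square[of "\<kappa> x"] by (simp add: mult.commute)
  then show ?thesis by simp
qed

lemma \<kappa>_sum: "\<kappa> (sum f A) = (\<Prod>x\<in>A. \<kappa> (f x))"
  by (induction A rule: infinite_finite_induct) (auto simp: \<kappa>_add)

lemma \<kappa>_frob_root [simp]: "\<kappa> (frob_root x) = \<kappa> x"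
  by (metis \<kappa>_frob frob_root_power)

text \<open>Orthogonality: for nonzero \<open>d\<close>, translating \<open>x\<close> by
  \<open>z / d\<close> multiplies the sum by \<open>\<kappa> z\<close>, which is not 1.\<close>

lemma sum_\<kappa>_mult: "(\<Sum>x\<in>UNIV. \<kappa> (x * d)) = (if d = 0 then of_nat CARD('a) else 0)"
proof (cases "d = 0")
  case False
  obtain z where z: "\<kappa> z \<noteq> 1" using \<kappa>_nontrivial by blast
  have "(\<Sum>x\<in>UNIV. \<kappa> (x * d)) = (\<Sum>x\<in>UNIV. \<kappa> ((x + z / d) * d))"
    by (rule sum.reindex_bij_witness[of _ "\<lambda>x. x + z / d" "\<lambda>x. x - z / d"]) auto
  also have "\<dots> = (\<Sum>x\<in>UNIV. \<kappa> (x * d)) * \<kappa> z"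
    using False by (simp add: ring_distribs \<kappa>_add sum_distrib_right)
  finally show ?thesis using z False by (simp add: mult_cancel_left1)
qed auto

end

subsection \<open>Integral and rational Laurent series\<close>

text \<open>
  Laurent series in \<open>1/t\<close> are formal Laurent series in the variable \<open>X = 1/t\<close>: the coefficient
  of \<open>t^n\<close> is the one of index \<open>-n\<close>.
\<close>

definition emb :: "'a::comm_ring_1 poly \<Rightarrow> 'a fls" where
  "emb u = Abs_fls (\<lambda>n. if n \<le> 0 then coeff u (nat (- n)) else 0)"

lemma emb_nth [simp]: "fls_nth (emb u) n = (if n \<le> 0 then coeff u (nat (- n)) else 0)"
proof -
  have "\<exists>N. \<forall>n<N. (if n \<le> 0 then coeff u (nat (- n)) else 0) = 0"
    by (intro exI[of _ "- int (degree u)"]) (auto intro!: coeff_eq_0)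
  from nth_Abs_fls_ex_lower_bound[OF this] show ?thesis by (simp add: emb_def)
qed

lemma emb_0 [simp]: "emb 0 = 0"
  by (rule fls_eqI) simp

lemma emb_add [simp]: "emb (u + v) = emb u + emb v"
  by (rule fls_eqI) simp

lemma emb_diff [simp]: "emb (u - v) = emb u - emb v"
  by (rule fls_eqI) simp

lemma emb_pCons: "emb (pCons a u) = fls_const a + fls_X_inv * emb u"
  by (rule fls_eqI) (auto simp: fls_X_inv_times_conv_shift coeff_pCons nat_diff_distrib split: nat.splits)

lemma emb_1 [simp]: "emb 1 = 1"
  by (rule fls_eqI) (auto simp: coeff_pCons one_pCons split: nat.splits)

lemma emb_smult: "emb (smult a u) = fls_const a * emb u"
  by (rule fls_eqI) simp

lemma emb_mult [simp]: "emb (u * v) = emb u * emb v"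
  by (induction u) (simp_all add: emb_pCons emb_smult ring_distribs mult.assoc)

lemma emb_power [simp]: "emb (u ^ n) = emb u ^ n"
  by (induction n) simp_all

lemma emb_of_nat [simp]: "emb (of_nat n) = of_nat n"
  by (induction n) simp_all

lemma emb_sum [simp]: "emb (sum f A) = (\<Sum>x\<in>A. emb (f x))"
  by (induction A rule: infinite_finite_induct) simp_all

lemma emb_prod [simp]: "emb (prod f A) = (\<Prod>x\<in>A. emb (f x))"
  by (induction A rule: infinite_finite_induct) simp_all

lemma emb_eq_iff [simp]: "emb u = emb v \<longleftrightarrow> u = v"
proof
  assume *: "emb u = emb v"
  show "u = v"
  proof (rule poly_eqI)
    fix n show "coeff u n = coeff v n"
      using arg_cong[OF *, of "\<lambda>f. fls_nth f (- int n)"] by simp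
  qed
qed simp

lemma emb_eq_0_iff [simp]: "emb u = 0 \<longleftrightarrow> u = 0"
  using emb_eq_iff[of u 0] by (simp del: emb_eq_iff)

lemma in_range_emb_iff: "f \<in> range emb \<longleftrightarrow> (\<forall>n>0. fls_nth f n = 0)"
proof
  assume *: "\<forall>n>0. fls_nth f n = 0"
  obtain N where N: "\<forall>n>N. fls_nth f (- int n) = 0"
    by (rule fls_nth_vanishes_below_natE)
  define u where "u = (\<Sum>i\<le>N. monom (fls_nth f (- int i)) i)"
  have "coeff u n = fls_nth f (- int n)" for n
    using N by (auto simp: u_def coeff_sum)
  then have "f = emb u"
    using * by (intro fls_eqI) auto
  then show "f \<in> range emb" by blast
qed auto

section \<open>Rational series: closure properties and common denominators\<close>

definition rational_fls :: "'a::field fls \<Rightarrow> bool" where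
  "rational_fls f \<longleftrightarrow> (\<exists>b. b \<noteq> 0 \<and> emb b * f \<in> range emb)"

lemma rational_fls_emb [simp]: "rational_fls (emb u)"
  unfolding rational_fls_def by (rule exI[of _ 1]) auto

lemma rational_fls_0 [simp]: "rational_fls 0"
  using rational_fls_emb[of 0] by simp

lemma rational_fls_add:
  assumes "rational_fls f" "rational_fls g" shows "rational_fls (f + g)"
proof -
  obtain b c x y where "b \<noteq> 0" "c \<noteq> 0" "emb b * f = emb x" "emb c * g = emb y"
    using assms unfolding rational_fls_def by auto
  moreover have "emb (b * c) * (f + g) = emb c * (emb b * f) + emb b * (emb c * g)"
    by (simp add: algebra_simps)
  ultimately have "b * c \<noteq> 0" "emb (b * c) * (f + g) = emb (c * x + b * y)"
    by simp_all
  then show ?thesis unfolding rational_fls_def by blast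
qed

lemma rational_fls_mult:
  assumes "rational_fls f" "rational_fls g" shows "rational_fls (f * g)"
proof -
  obtain b c x y where "b \<noteq> 0" "c \<noteq> 0" "emb b * f = emb x" "emb c * g = emb y"
    using assms unfolding rational_fls_def by auto
  moreover have "emb (b * c) * (f * g) = (emb b * f) * (emb c * g)"
    by (simp add: algebra_simps)
  ultimately have "b * c \<noteq> 0" "emb (b * c) * (f * g) = emb (x * y)"
    by simp_all
  then show ?thesis unfolding rational_fls_def by blast
qed

lemma rational_fls_inverse_emb: "rational_fls (inverse (emb u))"
proof (cases "u = 0")
  case False
  then have "emb u * inverse (emb u) = emb 1"
    by simp
  with False show ?thesis unfolding rational_fls_def by blast
qed simp

lemma rational_fls_mult_emb_iff:
  "u \<noteq> 0 \<Longrightarrow> rational_fls (f * emb u) \<longleftrightarrow> rational_fls f"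
  using rational_fls_mult[OF _ rational_fls_inverse_emb, of "f * emb u" u]
    rational_fls_mult[OF _ rational_fls_emb, of f u] by (auto simp: mult.assoc)

lemma rational_fls_diff:
  fixes f g :: "'a::field fls"
  assumes "rational_fls f" "rational_fls g" shows "rational_fls (f - g)"
proof -
  have "rational_fls (g * emb (- 1))"
    using assms(2) by (subst rational_fls_mult_emb_iff) auto
  moreover have "emb (- 1) = (- 1 :: 'a fls)"
    using emb_diff[of 0 "1 :: 'a poly"] by simp
  ultimately have "rational_fls (- g)"
    by (metis mult_minus1_right)
  from rational_fls_add[OF assms(1) this] show ?thesis by simp
qed

lemma common_denominator:
  assumes "finite A" "\<And>x. x \<in> A \<Longrightarrow> rational_fls (f x)"
  obtains b where "b \<noteq> 0" "\<And>x. x \<in> A \<Longrightarrow> emb b * f x \<in> range emb"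
proof -
  have "\<forall>x\<in>A. \<exists>b. b \<noteq> 0 \<and> emb b * f x \<in> range emb"
    using assms(2) by (auto simp: rational_fls_def)
  then obtain b where b: "\<And>x. x \<in> A \<Longrightarrow> b x \<noteq> 0 \<and> emb (b x) * f x \<in> range emb"
    by (auto simp: bchoice_iff)
  show ?thesis
  proof (rule that[of "prod b A"])
    show "prod b A \<noteq> 0" using b assms(1) by simp
    fix x assume x: "x \<in> A"
    then obtain y where y: "emb (b x) * f x = emb y" using b by auto
    have "emb (prod b A) * f x = emb (prod b (A - {x})) * (emb (b x) * f x)"
      using assms(1) x by (simp add: prod.remove[of A x] del: emb_prod)
    also have "\<dots> = emb (prod b (A - {x}) * y)"
      by (simp add: y)
    finally show "emb (prod b A) * f x \<in> range emb" by blast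
  qed
qed

text \<open>Induction on the degree. If \<open>G\<close> takes a rational value \<open>c\<close> at
  \<open>y0\<close>, divide \<open>G - c\<close> by the linear factor at \<open>y0\<close>: the
  quotient \<open>H\<close> still has an irrational coefficient, and away from \<open>y0\<close> it
  is rational wherever \<open>G\<close> is.\<close>

lemma irrational_coeff_imp_finite_rational_values:
  fixes G :: "'a::field fls poly"
  assumes "\<not> rational_fls (coeff G m)"
  shows "finite {y. rational_fls (poly G (emb y))}"
  using assms
proof (induction "degree G" arbitrary: G m rule: less_induct)
  case less
  show ?case
  proof (cases "\<exists>y0. rational_fls (poly G (emb y0))")
    case True
    then obtain y0 where y0: "rational_fls (poly G (emb y0))" by blast
    define H where "H = synthetic_div G (emb y0)"
    define c where "c = poly G (emb y0)"
    have G: "G = [:- emb y0, 1:] * H + [:c:]"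
      unfolding H_def c_def using synthetic_div_correct'[of "emb y0" G] by simp
    have "degree G \<noteq> 0"
    proof
      assume "degree G = 0"
      then obtain d where "G = [:d:]" by (metis degree_eq_zeroE)
      then show False using less.prems y0 by (cases m) (auto simp: coeff_pCons)
    qed
    then have deg: "degree H < degree G"
      unfolding H_def by (simp add: degree_synthetic_div)
    \<comment> \<open>\<open>G\<close> is the linear factor times \<open>H\<close> plus a rational
      constant, so rational coefficients of \<open>H\<close> would make those of \<open>G\<close>
      rational.\<close>
    obtain j where j: "\<not> rational_fls (coeff H j)"
    proof (rule ccontr)
      assume "\<not> thesis"
      then have rat: "rational_fls (coeff H j)" for j using that by blast
      have "coeff G m = coeff (pCons c H) m - emb y0 * coeff H m"
        by (subst G) (simp add: coeff_pCons split: nat.splits)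
      moreover have "rational_fls (coeff (pCons c H) m)"
        using rat y0 by (simp add: coeff_pCons c_def split: nat.splits)
      ultimately have "rational_fls (coeff G m)"
        using rat by (simp add: rational_fls_diff rational_fls_mult)
      with less.prems show False by simp
    qed
    have "{y. rational_fls (poly G (emb y))} \<subseteq> insert y0 {y. rational_fls (poly H (emb y))}"
    proof
      fix y assume "y \<in> {y. rational_fls (poly G (emb y))}"
      then have y: "rational_fls (poly G (emb y))" by simp
      have "poly G (emb y) = (emb y - emb y0) * poly H (emb y) + c"
        by (subst G) (simp add: algebra_simps)
      then have "poly H (emb y) * emb (y - y0) = poly G (emb y) - c"
        by (simp add: mult.commute)
      moreover have "rational_fls (poly G (emb y) - c)"
        using y y0 by (simp add: c_def rational_fls_diff)
      ultimately have "rational_fls (poly H (emb y) * emb (y - y0))"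
        by simp
      then show "y \<in> insert y0 {y. rational_fls (poly H (emb y))}"
        using rational_fls_mult_emb_iff[of "y - y0" "poly H (emb y)"] by auto
    qed
    then show ?thesis
      using less.hyps[OF deg j] by (meson finite.insertI finite_subset)
  next
    case False
    then show ?thesis by simp
  qed
qed

subsection \<open>The Cartier operator\<close>

text \<open>In powers of \<open>t\<close>, the new coefficient of \<open>t^j\<close> is the
  \<open>p\<close>-th root of the old one of \<open>t^(p j + p - 1)\<close>. With this offset index
  1, the place of \<open>t^-1\<close>, is read from index 1.\<close>

definition cartier :: "'a::{field,finite} fls \<Rightarrow> 'a fls" where
  "cartier f = Abs_fls (\<lambda>n. frob_root (fls_nth f (int CHAR('a) * n - int CHAR('a) + 1)))"

lemma cartier_nth [simp]:
  "fls_nth (cartier f) n =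
     frob_root (fls_nth (f :: 'a::{field,finite} fls) (int CHAR('a) * n - int CHAR('a) + 1))"
proof -
  obtain N where N: "\<forall>n<N. fls_nth f n = 0" by (rule fls_nth_vanishes_belowE)
  have p: "int CHAR('a) \<ge> 2"
    using prime_ge_2_nat[OF prime_CHAR_finite_field[where ?'a = 'a]] by simp
  have "int CHAR('a) * n - int CHAR('a) + 1 < N" if n: "n < - \<bar>N\<bar>" for n
  proof -
    have "int CHAR('a) * n \<le> 1 * n" using n p by (intro mult_right_mono_neg) auto
    then show ?thesis using n p by linarith
  qed
  then have "\<exists>N. \<forall>n<N. frob_root (fls_nth f (int CHAR('a) * n - int CHAR('a) + 1)) = 0"
    using N by (intro exI[of _ "- \<bar>N\<bar>"]) auto
  from nth_Abs_fls_ex_lower_bound[OF this] show ?thesis by (simp add: cartier_def)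
qed

lemma cartier_0 [simp]: "cartier 0 = 0"
  by (rule fls_eqI) simp

lemma cartier_add: "cartier (f + g) = cartier f + cartier g"
  by (rule fls_eqI) (simp add: frob_root_add)

lemma cartier_X_inv_power:
  "cartier (fls_X_inv ^ CHAR('a) * f) = fls_X_inv * cartier (f :: 'a::{field,finite} fls)"
  by (rule fls_eqI)
    (simp add: fls_X_inv_power_times_conv_shift fls_X_inv_times_conv_shift algebra_simps)

lemma cartier_const_power:
  "cartier (fls_const a ^ CHAR('a) * f) = fls_const a * cartier (f :: 'a::{field,finite} fls)"
  by (rule fls_eqI)
    (simp flip: fls_const_power add: frob_root_mult frob_root_eqI)

text \<open>The freshman's dream splits the \<open>p\<close>-th power of \<open>a + t u\<close>, so
  by induction constants and the factor \<open>t\<close> suffice.\<close>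

lemma cartier_mult_emb_power:
  "cartier (f * emb u ^ CHAR('a)) = cartier (f :: 'a::{field,finite} fls) * emb u"
proof (induction u arbitrary: f)
  case 0
  have "(0::'a fls) ^ CHAR('a) = 0"
    by (simp add: zero_power prime_gt_0_nat prime_CHAR_finite_field)
  then show ?case by (simp only: emb_0 mult_zero_right cartier_0)
next
  case (pCons a u)
  have "emb (pCons a u) ^ CHAR('a) = fls_const a ^ CHAR('a) + (fls_X_inv * emb u) ^ CHAR('a)"
    unfolding emb_pCons by (rule freshmans_dream) (simp_all add: prime_CHAR_finite_field)
  then have "cartier (f * emb (pCons a u) ^ CHAR('a)) =
      cartier (fls_const a ^ CHAR('a) * f + fls_X_inv ^ CHAR('a) * f * emb u ^ CHAR('a))"
    by (simp add: algebra_simps power_mult_distrib)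
  also have "\<dots> = fls_const a * cartier f + fls_X_inv * cartier f * emb u"
    by (simp only: cartier_add cartier_const_power pCons.IH cartier_X_inv_power)
  finally show ?case by (simp add: emb_pCons algebra_simps)
qed

abbreviation cartier_iter :: "nat \<Rightarrow> 'a::{field,finite} fls \<Rightarrow> 'a fls" where
  "cartier_iter i \<equiv> cartier ^^ i"

lemma cartier_iter_0 [simp]: "cartier_iter i 0 = 0"
  by (induction i) simp_all

lemma cartier_iter_add: "cartier_iter i (f + g) = cartier_iter i f + cartier_iter i g"
  by (induction i) (simp_all add: cartier_add)

lemma cartier_iter_sum: "cartier_iter i (sum f A) = (\<Sum>x\<in>A. cartier_iter i (f x))"
  by (induction A rule: infinite_finite_induct) (simp_all add: cartier_iter_add)

lemma cartier_iter_mult_emb_power: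
  "cartier_iter i (f * emb u ^ (CHAR('a) ^ i)) = cartier_iter i (f :: 'a::{field,finite} fls) * emb u"
proof (induction i arbitrary: u)
  case (Suc i)
  have "f * emb u ^ (CHAR('a) ^ Suc i) = f * emb (u ^ CHAR('a)) ^ (CHAR('a) ^ i)"
    by (simp add: power_mult)
  then show ?case
    using Suc[of "u ^ CHAR('a)"] by (simp add: cartier_mult_emb_power power_mult)
qed simp

text \<open>
  With \<open>b\<close> a common denominator of the \<open>cartier (f t^j)\<close> for \<open>j < p\<close>, the series \<open>f b^p\<close> has all its
  \<open>cartier (f b^p t^j)\<close> integral; together these cover every coefficient of \<open>f b^p\<close>.
\<close>

lemma cartier_irrational:
  fixes f :: "'a::{field,finite} fls"
  assumes "\<not> rational_fls f"
  obtains w where "\<not> rational_fls (cartier (f * emb w))"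
proof (rule ccontr)
  define p where "p = CHAR('a)"
  have p: "p > 0" unfolding p_def by (simp add: prime_gt_0_nat prime_CHAR_finite_field)
  assume "\<not> thesis"
  then have rat: "rational_fls (cartier (f * emb w))" for w using that by blast
  obtain b where b: "b \<noteq> 0"
    "\<And>j. j \<in> {..<p} \<Longrightarrow> emb b * cartier (f * emb (monom 1 j)) \<in> range emb"
    using common_denominator[of "{..<p}" "\<lambda>j. cartier (f * emb (monom 1 j))"] rat by auto
  define g where "g = f * emb b ^ p"
  have "fls_nth g m = 0" if m: "m > 0" for m
  proof -
    \<comment> \<open>Division of \<open>m - 1\<close> by \<open>p\<close>: up to a
      \<open>p\<close>-th root, the coefficient of \<open>g\<close> at \<open>m\<close> is that of
      \<open>cartier (g t^j)\<close> at the positive index \<open>n\<close>.\<close>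
    define j where "j = nat ((m - 1) mod int p)"
    define n where "n = (m - 1) div int p + 1"
    have mn: "m - 1 = int p * (n - 1) + int j"
      using p by (simp add: n_def j_def)
    have n: "n > 0" using m p by (simp add: n_def pos_imp_zdiv_nonneg_iff add_pos_nonneg add.commute)
    have j: "j < p" using p by (simp add: j_def nat_less_iff)
    have "emb b * cartier (f * emb (monom 1 j)) = cartier (g * emb (monom 1 j))"
      unfolding g_def p_def using cartier_mult_emb_power[of "f * emb (monom 1 j)" b]
      by (simp add: mult_ac)
    then have "fls_nth (cartier (g * emb (monom 1 j))) n = 0"
      using b(2)[of j] j n by (auto simp: in_range_emb_iff)
    moreover have "emb (monom 1 j) = (fls_X_inv ^ j :: 'a fls)"
      by (rule fls_eqI) auto
    ultimately have "fls_nth g (int p * n - int p + 1 + int j) = 0"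
      by (simp add: fls_X_inv_power_times_conv_shift p_def)
    moreover have "int p * n - int p + 1 + int j = m"
      using mn by (simp add: algebra_simps)
    ultimately show ?thesis by simp
  qed
  then have "rational_fls (f * emb (b ^ p))"
    using rational_fls_emb by (metis g_def emb_power in_range_emb_iff imageE)
  then show False
    using assms b(1) rational_fls_mult_emb_iff[of "b ^ p" f] by simp
qed

text \<open>Each step applies \<open>cartier_irrational\<close>; its multiplier \<open>w'\<close>
  passes inside the earlier iterates as a \<open>p^v\<close>-th power.\<close>

lemma cartier_iter_irrational:
  fixes f :: "'a::{field,finite} fls"
  assumes "\<not> rational_fls f"
  shows "\<exists>w. \<not> rational_fls (cartier_iter v (f * emb w))"
proof (induction v)
  case 0
  then show ?case using assms by (intro exI[of _ 1]) simp
next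
  case (Suc v)
  then obtain w where "\<not> rational_fls (cartier_iter v (f * emb w))" by blast
  then obtain w' where w': "\<not> rational_fls (cartier (cartier_iter v (f * emb w) * emb w'))"
    by (rule cartier_irrational)
  have "cartier_iter v (f * emb w) * emb w' = cartier_iter v (f * emb (w * w' ^ (CHAR('a) ^ v)))"
    using cartier_iter_mult_emb_power[of v "f * emb w" w'] by (simp add: mult.assoc)
  then show ?case
    using w' by (intro exI[of _ "w * w' ^ (CHAR('a) ^ v)"]) simp
qed

subsection \<open>Averages along Folner sequences\<close>

definition avg :: "'b set \<Rightarrow> ('b \<Rightarrow> complex) \<Rightarrow> complex" where
  "avg A f = sum f A / of_nat (card A)"

lemma avg_mult_left: "avg A (\<lambda>x. c * f x) = c * avg A f"
  by (simp add: avg_def sum_distrib_left)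

lemma avg_sum: "avg A (\<lambda>x. \<Sum>i\<in>I. f i x) = (\<Sum>i\<in>I. avg A (f i))"
  unfolding avg_def by (subst sum.swap) (simp add: sum_divide_distrib)

lemma norm_avg_le:
  assumes "\<And>x. x \<in> A \<Longrightarrow> norm (f x) \<le> 1"
  shows "norm (avg A f) \<le> 1"
proof -
  have "norm (sum f A) \<le> of_nat (card A) * 1"
    by (rule sum_norm_bound) (use assms in auto)
  then show ?thesis
    by (cases "card A = 0") (auto simp: avg_def norm_divide divide_le_eq)
qed

text \<open>Cauchy-Schwarz. The right side stays an average of \<open>f * cnj f\<close>, which for a
  sum of shifts expands into correlations.\<close>

lemma norm_avg_square_le: "(norm (avg A f))\<^sup>2 \<le> norm (avg A (\<lambda>x. f x * cnj (f x)))"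
proof (cases "card A = 0")
  case False
  have "(norm (sum f A))\<^sup>2 \<le> (\<Sum>x\<in>A. norm (f x))\<^sup>2"
    by (intro power_mono norm_sum) auto
  also have "\<dots> \<le> (\<Sum>x\<in>A. (norm (f x))\<^sup>2) * of_nat (card A)"
    by (rule sum_squared_le_sum_of_squares)
  also have "(\<Sum>x\<in>A. (norm (f x))\<^sup>2) = norm (\<Sum>x\<in>A. f x * cnj (f x))"
  proof -
    have "(\<Sum>x\<in>A. f x * cnj (f x)) = of_real (\<Sum>x\<in>A. (norm (f x))\<^sup>2)"
      by (simp only: of_real_sum complex_norm_square)
    then show ?thesis by (simp only: norm_of_real) (simp add: sum_nonneg)
  qed
  finally show ?thesis
    using False by (simp add: avg_def norm_divide power_divide field_simps power2_eq_square)
qed (simp add: avg_def)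

section \<open>Shift invariance of Folner averages and van der Corput's inequality\<close>

lemma folner_finite [simp]: "folner F \<Longrightarrow> finite (F N)"
  and folner_card_pos: "folner F \<Longrightarrow> card (F N) > 0"
  by (auto simp: folner_def card_gt_0_iff)

text \<open>Shifting the argument replaces \<open>F N\<close> by its translate. The two sums differ
  only on the symmetric difference, which is negligible by the Folner property.\<close>

lemma folner_shift:
  fixes F :: "nat \<Rightarrow> 'a::comm_ring_1 poly set"
  assumes F: "folner F" and f: "\<And>u. norm (f u) \<le> 1"
  shows "(\<lambda>N. avg (F N) (\<lambda>u. f (u + h)) - avg (F N) f) \<longlonglongrightarrow> 0"
proof (rule Lim_null_comparison)
  define r where "r N = real (card (F N \<inter> (\<lambda>x. x + h) ` F N)) / real (card (F N))" for N
  have "r \<longlonglongrightarrow> 1" using F unfolding folner_def r_def by blast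
  then have "(\<lambda>N. 2 * (1 - r N)) \<longlonglongrightarrow> 2 * (1 - 1)"
    by (intro tendsto_intros)
  then show "(\<lambda>N. 2 * (1 - r N)) \<longlonglongrightarrow> 0" by simp
  show "\<forall>\<^sub>F N in sequentially. norm (avg (F N) (\<lambda>u. f (u + h)) - avg (F N) f) \<le> 2 * (1 - r N)"
  proof (intro always_eventually allI)
    fix N
    define A B where "A = F N" and "B = (\<lambda>x. x + h) ` F N"
    have fin: "finite A" "finite B" using F by (auto simp: A_def B_def)
    have card: "card B = card A" unfolding A_def B_def by (intro card_image inj_onI) auto
    have bound: "norm (sum f X) \<le> real (card X)" for X
      using sum_norm_bound[of X f 1] f by simp
    have "(\<Sum>u\<in>A. f (u + h)) = sum f B"
      unfolding A_def B_def by (subst sum.reindex) (auto intro: inj_onI)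
    then have "norm ((\<Sum>u\<in>A. f (u + h)) - sum f A) = norm (sum f (B - A) - sum f (A - B))"
      using sum.Int_Diff[OF fin(1), of f B] sum.Int_Diff[OF fin(2), of f A] by (simp add: Int_commute)
    also have "\<dots> \<le> real (card (B - A)) + real (card (A - B))"
      by (rule order_trans[OF norm_triangle_ineq4 add_mono[OF bound bound]])
    also have "\<dots> = 2 * (real (card A) - real (card (A \<inter> B)))"
      using card_Diff_subset_Int[of B A] card_Diff_subset_Int[of A B] fin card
        card_mono[of A "A \<inter> B"] by (simp add: Int_commute of_nat_diff)
    finally have "norm ((\<Sum>u\<in>A. f (u + h)) - sum f A) / real (card A)
        \<le> 2 * (real (card A) - real (card (A \<inter> B))) / real (card A)"
      by (rule divide_right_mono) simp
    also have "\<dots> = 2 * (1 - r N)"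
      using folner_card_pos[OF F, of N] by (simp add: r_def A_def B_def field_simps)
    finally show "norm (avg (F N) (\<lambda>u. f (u + h)) - avg (F N) f) \<le> 2 * (1 - r N)"
      by (simp add: avg_def A_def norm_divide flip: diff_divide_distrib)
  qed
qed

lemma folner_shift_tendsto_0:
  fixes F :: "nat \<Rightarrow> 'a::comm_ring_1 poly set"
  assumes "folner F" "\<And>u. norm (f u) \<le> 1" "(\<lambda>N. avg (F N) f) \<longlonglongrightarrow> 0"
  shows "(\<lambda>N. avg (F N) (\<lambda>u. f (u + h))) \<longlonglongrightarrow> 0"
  using tendsto_add[OF folner_shift[where f = f and h = h, OF assms(1,2)] assms(3)] by simp

text \<open>Replacing \<open>f\<close> by its mean \<open>g\<close> over \<open>n\<close> shifts
  changes the averages by a null sequence. In the mean square of \<open>g\<close> the diagonal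
  contributes at most \<open>1 / n\<close>, and the other correlations tend to 0.\<close>

lemma van_der_corput:
  fixes F :: "nat \<Rightarrow> 'a::comm_ring_1 poly set" and h :: "nat \<Rightarrow> 'a poly"
  assumes F: "folner F" and f: "\<And>u. norm (f u) \<le> 1"
    and h: "\<And>i j. i \<noteq> j \<Longrightarrow>
      (\<lambda>N. avg (F N) (\<lambda>u. f (u + (h i - h j)) * cnj (f u))) \<longlonglongrightarrow> 0"
  shows "(\<lambda>N. avg (F N) f) \<longlonglongrightarrow> 0"
proof (rule tendstoI)
  fix e :: real assume e: "e > 0"
  obtain n where n: "n > 0" "sqrt (1 / real n) < e"
  proof -
    obtain n where "1 / e\<^sup>2 < real n" using reals_Archimedean2 by blast
    moreover from this have "real n > 0" using e by (meson less_trans zero_less_divide_1_iff zero_less_power)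
    ultimately have "n > 0" "1 / real n < e\<^sup>2" using e by (auto simp: field_simps)
    then show ?thesis using that[of n] e by (metis real_sqrt_less_iff real_sqrt_unique less_imp_le)
  qed
  define c where "c i j N = avg (F N) (\<lambda>u. f (u + h i) * cnj (f (u + h j)))" for i j N
  \<comment> \<open>Translation by \<open>h j\<close> turns this correlation into the one assumed
    for \<open>h i - h j\<close>.\<close>
  have c0: "c i j \<longlonglongrightarrow> 0" if "i \<noteq> j" for i j
    using folner_shift_tendsto_0[OF F _ h[OF that], where h = "h j"] f
    by (simp add: c_def[abs_def] norm_mult mult_le_one algebra_simps)
  have c1: "norm (c i i N) \<le> 1" for i N
    unfolding c_def by (intro norm_avg_le) (simp add: norm_mult mult_le_one f)
  define g where "g u = (\<Sum>i<n. f (u + h i)) / of_nat n" for u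
  \<comment> \<open>Bound for the mean square of \<open>g\<close>: each of the \<open>n\<close>
    diagonal terms counts at most 1.\<close>
  define B where "B N = (real n + (\<Sum>i<n. \<Sum>j\<in>{..<n}-{i}. norm (c i j N))) / (real n)\<^sup>2" for N
  have "B \<longlonglongrightarrow> (real n + (\<Sum>i<n. \<Sum>j\<in>{..<n}-{i}. 0)) / (real n)\<^sup>2"
    unfolding B_def[abs_def] using n(1)
    by (intro tendsto_intros tendsto_norm_zero c0) auto
  then have B: "B \<longlonglongrightarrow> 1 / real n"
    using n(1) by (simp add: power2_eq_square)
  have avg_g: "norm (avg (F N) g) \<le> sqrt (B N)" for N
  proof (rule real_le_rsqrt)
    have "g u * cnj (g u) = (1 / of_nat n ^ 2) * (\<Sum>i<n. \<Sum>j<n. f (u + h i) * cnj (f (u + h j)))" for u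
      unfolding g_def by (simp add: sum_product power2_eq_square)
    then have "avg (F N) (\<lambda>u. g u * cnj (g u)) = (1 / of_nat n ^ 2) * (\<Sum>i<n. \<Sum>j<n. c i j N)"
      by (simp only: avg_mult_left avg_sum c_def)
    moreover have "norm (\<Sum>i<n. \<Sum>j<n. c i j N) \<le> (\<Sum>i<n. \<Sum>j<n. norm (c i j N))"
      by (intro order_trans[OF norm_sum] sum_mono norm_sum)
    moreover have "(\<Sum>i<n. \<Sum>j<n. norm (c i j N)) \<le>
        (\<Sum>i<n. 1 + (\<Sum>j\<in>{..<n}-{i}. norm (c i j N)))"
      using c1 by (intro sum_mono) (simp add: sum.remove[of "{..<n}"])
    ultimately have "norm (avg (F N) (\<lambda>u. g u * cnj (g u))) \<le> B N"
      by (simp add: B_def norm_mult norm_divide norm_power sum.distrib divide_right_mono)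
    then show "(norm (avg (F N) g))\<^sup>2 \<le> B N"
      using norm_avg_square_le[of "F N" g] by simp
  qed
  have "(\<lambda>N. (\<Sum>i<n. avg (F N) (\<lambda>u. f (u + h i)) - avg (F N) f) / of_nat n) \<longlonglongrightarrow> (\<Sum>i<n. 0) / of_nat n"
    using n(1) by (intro tendsto_intros folner_shift F f) auto
  moreover have "(\<Sum>i<n. avg (F N) (\<lambda>u. f (u + h i)) - avg (F N) f) / of_nat n = avg (F N) g - avg (F N) f" for N
  proof -
    have "avg (F N) g = (\<Sum>i<n. avg (F N) (\<lambda>u. f (u + h i))) / of_nat n"
      unfolding g_def by (simp add: divide_inverse_commute avg_mult_left avg_sum)
    then show ?thesis using n(1) by (simp add: sum_subtractf field_simps)
  qed
  ultimately have "(\<lambda>N. avg (F N) g - avg (F N) f) \<longlonglongrightarrow> 0"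
    by simp
  then have "(\<lambda>N. norm (avg (F N) g - avg (F N) f) + sqrt (B N)) \<longlonglongrightarrow> norm (0::complex) + sqrt (1 / real n)"
    by (intro tendsto_intros B)
  then have "\<forall>\<^sub>F N in sequentially. norm (avg (F N) g - avg (F N) f) + sqrt (B N) < e"
    using n(2) by (intro order_tendstoD(2)) auto
  then show "\<forall>\<^sub>F N in sequentially. dist (avg (F N) f) 0 < e"
  proof (rule eventually_mono)
    fix N assume *: "norm (avg (F N) g - avg (F N) f) + sqrt (B N) < e"
    have "norm (avg (F N) f) \<le> norm (avg (F N) g) + norm (avg (F N) g - avg (F N) f)"
      using norm_triangle_ineq4[of "avg (F N) g" "avg (F N) g - avg (F N) f"] by simp
    then show "dist (avg (F N) f) 0 < e" using * avg_g[of N] by simp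
  qed
qed

subsection \<open>Reduction to exponents prime to the characteristic\<close>

text \<open>The coefficient at \<open>r\<close> once the terms of exponent \<open>p^i r\<close> are
  moved to \<open>r\<close>. For positive \<open>r\<close>, stopping at \<open>degree P\<close>
  loses nothing because \<open>p^i > i\<close>.\<close>

definition reduced_coeff :: "'a::{field,finite} fls poly \<Rightarrow> nat \<Rightarrow> 'a fls" where
  "reduced_coeff P r = (\<Sum>i\<le>degree P. cartier_iter i (coeff P (CHAR('a) ^ i * r)))"

lemma less_CHAR_power: "i < CHAR('a::{field,finite}) ^ i"
  by (rule less_le_trans[OF less_exp power_mono[OF prime_ge_2_nat[OF prime_CHAR_finite_field]]]) simp

lemma reduced_coeff_eq:
  fixes P :: "'a::{field,finite} fls poly"
  assumes "degree P \<le> d" "r > 0"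
  shows "reduced_coeff P r = (\<Sum>i\<le>d. cartier_iter i (coeff P (CHAR('a) ^ i * r)))"
  unfolding reduced_coeff_def
proof (rule sum.mono_neutral_left)
  show "\<forall>i\<in>{..d} - {..degree P}. cartier_iter i (coeff P (CHAR('a) ^ i * r)) = 0"
  proof
    fix i assume "i \<in> {..d} - {..degree P}"
    then have "degree P < CHAR('a) ^ i * 1" using less_CHAR_power[of i, where ?'a = 'a] by simp
    also have "\<dots> \<le> CHAR('a) ^ i * r" using assms(2) by (intro mult_left_mono) auto
    finally show "cartier_iter i (coeff P (CHAR('a) ^ i * r)) = 0" by (simp add: coeff_eq_0)
  qed
qed (use assms in auto)

lemma reduced_coeff_eq_0:
  fixes P :: "'a::{field,finite} fls poly"
  assumes "degree P < r"
  shows "reduced_coeff P r = 0"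
  unfolding reduced_coeff_def
proof (intro sum.neutral ballI)
  fix i
  have "r \<le> CHAR('a) ^ i * r"
    using less_CHAR_power[of i, where ?'a = 'a] by simp
  then have "degree P < CHAR('a) ^ i * r" using assms by (rule less_le_trans[rotated])
  then show "cartier_iter i (coeff P (CHAR('a) ^ i * r)) = 0" by (simp add: coeff_eq_0)
qed

text \<open>Exponent 0 is a multiple of \<open>p\<close>, so the constant term is dropped; it
  contributes only a fixed phase.\<close>

definition reduce :: "'a::{field,finite} fls poly \<Rightarrow> 'a fls poly" where
  "reduce P = (\<Sum>r | r \<le> degree P \<and> \<not> CHAR('a) dvd r. monom (reduced_coeff P r) r)"

lemma coeff_reduce:
  fixes P :: "'a::{field,finite} fls poly"
  shows "coeff (reduce P) r = (if CHAR('a) dvd r then 0 else reduced_coeff P r)"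
proof -
  have "finite {r. r \<le> degree P \<and> \<not> CHAR('a) dvd r}" by auto
  then show ?thesis
    using reduced_coeff_eq_0[of P r] by (auto simp: reduce_def coeff_sum not_le)
qed

text \<open>The binomial expansion of \<open>T(x + h) - T(x)\<close>, where \<open>T\<close> is the part of \<open>Q\<close> of degree at most \<open>k\<close>.\<close>

definition truncated_difference :: "nat \<Rightarrow> 'a::comm_ring_1 poly \<Rightarrow> 'a \<Rightarrow> 'a poly" where
  "truncated_difference k Q h =
     (\<Sum>r\<le>k. \<Sum>j<r. monom (of_nat (r choose j) * coeff Q r * h ^ (r - j)) j)"

lemma degree_truncated_difference: "degree (truncated_difference (Suc n) Q h) \<le> n"
  unfolding truncated_difference_def
  by (intro degree_sum_le) (auto intro: order_trans[OF degree_monom_le])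

lemma coeff_truncated_difference:
  "coeff (truncated_difference k Q h) j =
     (\<Sum>r\<in>{j<..k}. of_nat (r choose j) * coeff Q r * h ^ (r - j))"
proof -
  have "coeff (truncated_difference k Q h) j =
      (\<Sum>r\<le>k. if j < r then of_nat (r choose j) * coeff Q r * h ^ (r - j) else 0)"
    unfolding truncated_difference_def by (simp add: coeff_sum)
  also have "\<dots> = (\<Sum>r\<in>{..k} \<inter> {r. j < r}. of_nat (r choose j) * coeff Q r * h ^ (r - j))"
    by (rule sum.inter_restrict[symmetric, where B = "{r. j < r}", simplified]) simp
  also have "{..k} \<inter> {r. j < r} = {j<..k}" by auto
  finally show ?thesis .
qed

lemma poly_truncated_difference:
  "poly (truncated_difference k Q h) x = (\<Sum>r\<le>k. coeff Q r * ((x + h) ^ r - x ^ r))"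
proof -
  have "(x + h) ^ r - x ^ r = (\<Sum>j<r. of_nat (r choose j) * x ^ j * h ^ (r - j))" for r
    unfolding binomial_ring by (simp flip: lessThan_Suc_atMost)
  then show ?thesis
    by (simp add: truncated_difference_def poly_sum poly_monom sum_distrib_left mult_ac)
qed

text \<open>\<open>(u + h) ^ r - u ^ r\<close> is a multiple of \<open>h\<close>, hence of
  \<open>b\<close>, which clears the denominator of \<open>a\<close>.\<close>

lemma integral_difference:
  assumes "emb b * a \<in> range emb" "b dvd h"
  shows "a * ((emb u + emb h) ^ r - emb u ^ r) \<in> range (emb :: 'a::field poly \<Rightarrow> _)"
proof -
  have "h dvd (u + h) ^ r - u ^ r"
    using power_diff_sumr2[of "u + h" r u] by simp
  then obtain w where w: "(u + h) ^ r - u ^ r = b * w" using assms(2) by (meson dvd_def dvd_trans)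
  obtain z where z: "emb b * a = emb z" using assms(1) by auto
  have "(emb u + emb h) ^ r - emb u ^ r = emb ((u + h) ^ r - u ^ r)" by simp
  also have "a * \<dots> = emb (z * w)" unfolding w by (simp flip: z)
  finally show ?thesis by blast
qed

lemma emb_monom: "emb (monom c j) = fls_const c * fls_X_inv ^ j"
  by (rule fls_eqI) auto

lemma fls_nth_emb_monom_mult: "fls_nth (emb (monom c j) * f) n = c * fls_nth f (n + int j)"
  unfolding emb_monom mult.assoc fls_X_inv_power_times_conv_shift(1) by simp

section \<open>The additive character on Laurent series\<close>

context frobenius_character
begin

definition \<psi> :: "'a fls \<Rightarrow> complex" where
  "\<psi> f = \<kappa> (fls_nth f 1)"

lemma \<psi>_add: "\<psi> (f + g) = \<psi> f * \<psi> g"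
  and norm_\<psi> [simp]: "norm (\<psi> f) = 1"
  and \<psi>_0 [simp]: "\<psi> 0 = 1"
  and \<psi>_emb [simp]: "\<psi> (emb u) = 1"
  and \<psi>_cartier [simp]: "\<psi> (cartier f) = \<psi> f"
  by (simp_all add: \<psi>_def \<kappa>_add)

lemma \<psi>_diff: "\<psi> (f - g) = \<psi> f * cnj (\<psi> g)"
  using \<kappa>_add[of "fls_nth f 1" "- fls_nth g 1"] by (simp add: \<psi>_def \<kappa>_minus)

lemma \<psi>_sum: "\<psi> (sum f A) = (\<Prod>x\<in>A. \<psi> (f x))"
  by (induction A rule: infinite_finite_induct) (auto simp: \<psi>_add)

lemma \<psi>_cartier_iter: "\<psi> (cartier_iter i f) = \<psi> f"
  by (induction i) simp_all

lemma \<psi>_cartier_iter_mult: "\<psi> (cartier_iter i f * emb u ^ r) = \<psi> (f * emb u ^ (CHAR('a) ^ i * r))"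
proof -
  have "cartier_iter i f * emb u ^ r = cartier_iter i (f * emb u ^ (CHAR('a) ^ i * r))"
    using cartier_iter_mult_emb_power[of i f "u ^ r"] by (simp add: mult.commute flip: power_mult)
  then show ?thesis by (simp only: \<psi>_cartier_iter)
qed

text \<open>Every positive exponent is uniquely \<open>p^i * r\<close> with \<open>r\<close> prime
  to \<open>p\<close>. Grouping the phases of the terms by \<open>r\<close> gives the phases of the
  reduced terms.\<close>

lemma \<psi>_poly_reduce: "\<psi> (poly P (emb u)) = \<psi> (coeff P 0) * \<psi> (poly (reduce P) (emb u))"
proof -
  define p where "p = CHAR('a)"
  have p: "prime p" unfolding p_def by (rule prime_CHAR_finite_field)
  define d where "d = degree P"
  define R where "R = {r. r \<le> d \<and> \<not> p dvd r}"
  define t where "t n = \<psi> (coeff P n * emb u ^ n)" for n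
  define e where "e = (\<lambda>(r, i). p ^ i * r)"
  have mult: "multiplicity p (p ^ i * r) = i" if "\<not> p dvd r" for i r
    using that p by (intro multiplicity_eqI) auto
  have inj: "inj_on e (R \<times> {..d})"
  proof (rule inj_onI, clarify)
    fix r i s j assume *: "r \<in> R" "s \<in> R" "e (r, i) = e (s, j)"
    then have "i = j" using mult[of r i] mult[of s j] by (auto simp: e_def R_def)
    then show "r = s \<and> i = j" using * p by (auto simp: e_def prime_gt_0_nat)
  qed
  have "\<psi> (poly (reduce P) (emb u)) = (\<Prod>r\<in>R. \<psi> (reduced_coeff P r * emb u ^ r))"
    by (simp add: reduce_def poly_sum poly_monom \<psi>_sum R_def d_def p_def)
  also have "\<dots> = (\<Prod>r\<in>R. \<Prod>i\<le>d. t (e (r, i)))"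
    by (simp add: reduced_coeff_def sum_distrib_right \<psi>_sum \<psi>_cartier_iter_mult t_def e_def p_def d_def)
  also have "\<dots> = (\<Prod>z\<in>R \<times> {..d}. t (e z))"
    by (simp add: prod.cartesian_product)
  also have "\<dots> = (\<Prod>n\<in>e ` (R \<times> {..d}). t n)"
    using inj by (simp add: prod.reindex)
  \<comment> \<open>Exponents beyond the degree have phase 1. All of \<open>{1..d}\<close> is
    reached, since for \<open>n = p ^ i * r\<close> both \<open>r\<close> and
    \<open>i < p ^ i\<close> are at most \<open>n\<close>.\<close>
  also have "\<dots> = (\<Prod>n\<in>{1..d}. t n)"
  proof (rule prod.mono_neutral_right)
    show "finite (e ` (R \<times> {..d}))" by (auto simp: R_def)
    show "{1..d} \<subseteq> e ` (R \<times> {..d})"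
    proof
      fix n assume n: "n \<in> {1..d}"
      obtain r where r: "n = p ^ multiplicity p n * r" "\<not> p dvd r"
        by (rule multiplicity_decompose'[of n p]) (use n p in auto)
      have "multiplicity p n < p ^ multiplicity p n" using less_CHAR_power by (simp add: p_def)
      moreover have "p ^ multiplicity p n \<le> n" "r \<le> n"
        using n by (auto intro!: dvd_imp_le multiplicity_dvd) (use r(1) in \<open>metis dvd_triv_right\<close>)
      ultimately show "n \<in> e ` (R \<times> {..d})"
        using n r by (intro image_eqI[of _ _ "(r, multiplicity p n)"]) (auto simp: e_def R_def)
    qed
    show "\<forall>n\<in>e ` (R \<times> {..d}) - {1..d}. t n = 1"
    proof
      fix n assume n: "n \<in> e ` (R \<times> {..d}) - {1..d}"
      have "0 \<notin> e ` (R \<times> {..d})" using p by (auto simp: e_def R_def)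
      then have "n > 0" using n by (metis DiffD1 gr0I)
      with n have "n > d" by auto
      then show "t n = 1" by (simp add: t_def d_def coeff_eq_0)
    qed
  qed
  finally have "\<psi> (coeff P 0) * \<psi> (poly (reduce P) (emb u)) = t 0 * (\<Prod>n\<in>{1..d}. t n)"
    by (simp add: t_def)
  also have "\<dots> = (\<Prod>n\<le>d. t n)"
    by (simp add: atMost_atLeast0 prod.atLeast_Suc_atMost)
  also have "\<dots> = \<psi> (poly P (emb u))"
    by (simp add: t_def d_def poly_altdef \<psi>_sum)
  finally show ?thesis ..
qed

text \<open>By \<open>integral_difference\<close> the terms above \<open>k\<close> change by
  polynomials, on which \<psi> is 1.\<close>

lemma \<psi>_difference:
  assumes b: "\<And>r. r > k \<Longrightarrow> emb b * coeff Q r \<in> range emb" and h: "b dvd h"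
  shows "\<psi> (poly Q (emb (u + h))) * cnj (\<psi> (poly Q (emb u))) =
    \<psi> (poly (truncated_difference k Q (emb h)) (emb u))"
proof -
  define d where "d = k + degree Q"
  define s where "s r = coeff Q r * ((emb u + emb h) ^ r - emb u ^ r)" for r
  have "poly Q x = (\<Sum>r\<le>d. coeff Q r * x ^ r)" for x
    unfolding poly_altdef
    by (intro sum.mono_neutral_left) (auto simp: d_def coeff_eq_0)
  then have "poly Q (emb (u + h)) - poly Q (emb u) = (\<Sum>r\<le>d. s r)"
    by (simp add: s_def right_diff_distrib sum_subtractf)
  also have "\<dots> = (\<Sum>r\<le>k. s r) + (\<Sum>r\<in>{k<..d}. s r)"
    by (subst sum.union_disjoint[symmetric]) (auto intro!: sum.cong simp: d_def)
  finally have "\<psi> (poly Q (emb (u + h))) * cnj (\<psi> (poly Q (emb u))) =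
      \<psi> (poly (truncated_difference k Q (emb h)) (emb u)) * (\<Prod>r\<in>{k<..d}. \<psi> (s r))"
    by (simp flip: \<psi>_diff \<psi>_sum add: \<psi>_add poly_truncated_difference s_def)
  also have "(\<Prod>r\<in>{k<..d}. \<psi> (s r)) = 1"
  proof (rule prod.neutral, rule ballI)
    fix r assume "r \<in> {k<..d}"
    then have "s r \<in> range emb" unfolding s_def using integral_difference[OF b h] by simp
    then show "\<psi> (s r) = 1" by auto
  qed
  finally show ?thesis by simp
qed

text \<open>A monomial moves a nonzero coefficient at a positive index \<open>m\<close> to index 1
  and scales it to some \<open>z\<close> with \<open>\<kappa> z \<noteq> 1\<close>.\<close>

lemma \<psi>_nontrivial_on_multiples:
  assumes "f \<notin> range emb"
  obtains w where "\<psi> (f * emb w) \<noteq> 1"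
proof -
  obtain m where m: "m > 0" "fls_nth f m \<noteq> 0" using assms by (auto simp: in_range_emb_iff)
  obtain z where z: "\<kappa> z \<noteq> 1" using \<kappa>_nontrivial by blast
  have "fls_nth (emb (monom (z / fls_nth f m) (nat (m - 1))) * f) 1 = z"
    unfolding fls_nth_emb_monom_mult using m by simp
  then show thesis using z that by (metis \<psi>_def mult.commute)
qed

end

subsection \<open>Weyl sums\<close>

text \<open>The shift involves \<open>y\<close> only through \<open>y^(p^v)\<close>, so for
  \<open>i \<le> v\<close> the \<open>i\<close>-th Cartier iterate extracts a genuine power of
  \<open>y\<close>: the reduced coefficient is a polynomial in \<open>y\<close>. Its linear term
  isolates the coefficient of \<open>Q\<close> at \<open>Suc n\<close>.\<close>

lemma reduced_coeff_truncated_difference: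
  fixes Q :: "'a::{field,finite} fls poly" and c :: "'a poly" and s v :: nat
  defines "n \<equiv> CHAR('a) ^ v * s"
  assumes s: "s > 0"
  obtains G where
    "\<And>y. reduced_coeff (truncated_difference (Suc n) Q (emb (c * y ^ (CHAR('a) ^ v)))) s =
       poly G (emb y)"
    "coeff G 1 = cartier_iter v (of_nat (Suc n) * coeff Q (Suc n) * emb c)"
proof -
  define p where "p = CHAR('a)"
  have p: "p > 1" unfolding p_def by (rule prime_gt_1_nat[OF prime_CHAR_finite_field])
  define A where "A i r = of_nat (r choose (p ^ i * s)) * coeff Q r * emb c ^ (r - p ^ i * s)" for i r
  define G where "G = (\<Sum>i\<le>v. \<Sum>r\<in>{p ^ i * s<..Suc n}.
    monom (cartier_iter i (A i r)) (p ^ (v - i) * (r - p ^ i * s)))"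
  have "v \<le> n"
    using less_CHAR_power[of v, where ?'a = 'a] s by (auto simp: n_def intro: order_trans[of _ "CHAR('a) ^ v"])
  have n: "n > 0" using s p by (simp add: n_def p_def)
  show ?thesis
  proof (rule that[of G])
    fix y
    define D where "D = truncated_difference (Suc n) Q (emb (c * y ^ (CHAR('a) ^ v)))"
    have cartier_term: "cartier_iter i (of_nat (r choose (p ^ i * s)) * coeff Q r * emb (c * y ^ (p ^ v)) ^ (r - p ^ i * s))
        = cartier_iter i (A i r) * emb y ^ (p ^ (v - i) * (r - p ^ i * s))" if "i \<le> v" for i r
    proof -
      define m where "m = r - p ^ i * s"
      have "p ^ v * m = p ^ (v - i) * m * p ^ i"
        using that by (simp add: mult_ac flip: power_add)
      moreover have "emb (c * y ^ (p ^ v)) ^ m = emb c ^ m * emb y ^ (p ^ v * m)"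
        by (simp add: power_mult_distrib power_mult)
      ultimately have "emb (c * y ^ (p ^ v)) ^ m = emb c ^ m * emb (y ^ (p ^ (v - i) * m)) ^ (p ^ i)"
        by (simp only: emb_power power_mult)
      then show ?thesis
        using cartier_iter_mult_emb_power[of i "A i r" "y ^ (p ^ (v - i) * m)"]
        unfolding m_def[symmetric] A_def p_def[symmetric] by (simp only: mult.assoc emb_power)
    qed
    have "reduced_coeff D s = (\<Sum>i\<le>n. cartier_iter i (coeff D (p ^ i * s)))"
      unfolding p_def D_def using s by (intro reduced_coeff_eq degree_truncated_difference) auto
    \<comment> \<open>For \<open>i > v\<close> the exponent \<open>p ^ i * s\<close> exceeds
      \<open>n\<close>, which bounds the degree of \<open>D\<close>.\<close>
    also have "\<dots> = (\<Sum>i\<le>v. cartier_iter i (coeff D (p ^ i * s)))"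
    proof (rule sum.mono_neutral_right)
      show "\<forall>i\<in>{..n} - {..v}. cartier_iter i (coeff D (p ^ i * s)) = 0"
      proof
        fix i assume "i \<in> {..n} - {..v}"
        then have "p ^ v < p ^ i" using p by simp
        then have "n < p ^ i * s" using s by (simp add: n_def p_def)
        then have "degree D < p ^ i * s"
          unfolding D_def by (rule le_less_trans[OF degree_truncated_difference])
        then show "cartier_iter i (coeff D (p ^ i * s)) = 0" by (simp add: coeff_eq_0)
      qed
    qed (use \<open>v \<le> n\<close> in auto)
    also have "\<dots> = (\<Sum>i\<le>v. \<Sum>r\<in>{p ^ i * s<..Suc n}.
        cartier_iter i (A i r) * emb y ^ (p ^ (v - i) * (r - p ^ i * s)))"
      unfolding D_def coeff_truncated_difference cartier_iter_sum
      by (intro sum.cong refl) (simp only: cartier_term p_def[symmetric] atMost_iff)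
    also have "\<dots> = poly G (emb y)"
      by (simp add: G_def poly_sum poly_monom)
    finally show "reduced_coeff D s = poly G (emb y)" .
  next
    \<comment> \<open>Both factors must be 1, which forces \<open>i = v\<close> and then
      \<open>r = p ^ v * s + 1 = Suc n\<close>.\<close>
    have iff: "p ^ (v - i) * (r - p ^ i * s) = 1 \<longleftrightarrow> i = v \<and> r = Suc n"
      if "i \<le> v" "r \<in> {p ^ i * s<..Suc n}" for i r
      using that p by (auto simp: n_def p_def)
    have sing: "{p ^ v * s<..Suc n} = {Suc n}"
      by (auto simp: n_def p_def)
    have "coeff G 1 = (\<Sum>i\<le>v. \<Sum>r\<in>{p ^ i * s<..Suc n}.
        if i = v \<and> r = Suc n then cartier_iter i (A i r) else 0)"
      unfolding G_def coeff_sum coeff_monom by (intro sum.cong refl) (simp only: iff atMost_iff)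
    also have "\<dots> = (\<Sum>i\<le>v. if i = v then cartier_iter v (A v (Suc n)) else 0)"
      using sing by (intro sum.cong refl) auto
    also have "\<dots> = cartier_iter v (A v (Suc n))"
      by simp
    also have "A v (Suc n) = of_nat (Suc n) * coeff Q (Suc n) * emb c"
      by (simp add: A_def p_def flip: n_def)
    finally show "coeff G 1 = cartier_iter v (of_nat (Suc n) * coeff Q (Suc n) * emb c)" .
  qed
qed

text \<open>Distinct monomials of degrees above all those in \<open>B\<close> have differences of
  too large degree to lie in \<open>B\<close>.\<close>

lemma avoiding_differences:
  fixes B :: "'a::comm_ring_1 poly set"
  assumes "finite B"
  obtains y :: "nat \<Rightarrow> 'a poly" where "\<And>i j. i \<noteq> j \<Longrightarrow> y i - y j \<notin> B"
proof -
  define M where "M = Suc (Max (insert 0 (degree ` B)))"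
  have M: "degree b < M" if "b \<in> B" for b
    using assms that by (simp add: M_def less_Suc_eq_le)
  show thesis
  proof (rule that[of "\<lambda>i. monom 1 (M + i)"])
    fix i j :: nat assume "i \<noteq> j"
    then have "coeff (monom 1 (M + i) - monom 1 (M + j) :: 'a poly) (M + i) \<noteq> 0"
      by simp
    then have "M + i \<le> degree (monom 1 (M + i) - monom 1 (M + j) :: 'a poly)"
      by (rule le_degree)
    then show "(monom 1 (M + i) - monom 1 (M + j) :: 'a poly) \<notin> B"
      using M by (metis le_add1 le_trans not_le)
  qed
qed

context frobenius_character
begin

lemma avg_reduce_tendsto_0:
  assumes "(\<lambda>N. avg (F N) (\<lambda>u. \<psi> (poly (reduce P) (emb u)))) \<longlonglongrightarrow> 0"
  shows "(\<lambda>N. avg (F N) (\<lambda>u. \<psi> (poly P (emb u)))) \<longlonglongrightarrow> 0"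
  unfolding \<psi>_poly_reduce[of P] avg_mult_left using assms by (rule tendsto_mult_right_zero)

text \<open>\<open>n\<close> bounds only the exponents with irrational reduced coefficient, not the
  degree; \<open>P\<close> varies because the induction passes to difference polynomials.\<close>

lemma weyl_sums_tendsto_0_induct:
  assumes F: "folner F"
    and "\<And>r. r > n \<Longrightarrow> \<not> CHAR('a) dvd r \<Longrightarrow> rational_fls (reduced_coeff P r)"
    and "\<exists>r. \<not> CHAR('a) dvd r \<and> \<not> rational_fls (reduced_coeff P r)"
  shows "(\<lambda>N. avg (F N) (\<lambda>u. \<psi> (poly P (emb u)))) \<longlonglongrightarrow> 0"
  using assms(2,3)
proof (induction n arbitrary: P)
  \<comment> \<open>The irrational exponent would have to be 0, which \<open>CHAR('a)\<close>
    divides.\<close>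
  case 0
  then show ?case by (metis dvd_0_right neq0_conv)
next
  case (Suc n)
  show ?case
  proof (cases "CHAR('a) dvd Suc n \<or> rational_fls (reduced_coeff P (Suc n))")
    case True
    \<comment> \<open>\<open>Suc n\<close> carries no irrational coefficient that counts, so the
      hypotheses already hold with bound \<open>n\<close>.\<close>
    then show ?thesis using Suc by (metis Suc_lessI)
  next
    case False
    define p where "p = CHAR('a)"
    have p: "prime p" unfolding p_def by (rule prime_CHAR_finite_field)
    define Q where "Q = reduce P"
    define f where "f u = \<psi> (poly Q (emb u))" for u
    have norm_f: "norm (f u) \<le> 1" for u by (simp add: f_def)
    define \<Delta> where "\<Delta> h = truncated_difference (Suc n) Q (emb h)" for h
    have irr: "\<not> rational_fls (coeff Q (Suc n))"
      using False by (simp add: Q_def coeff_reduce)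
    have rat: "rational_fls (coeff Q r)" if "r > Suc n" for r
      using Suc.prems(1)[OF that] by (simp add: Q_def coeff_reduce)
    obtain b where b: "b \<noteq> 0" "\<And>r. r \<in> {Suc n<..degree Q} \<Longrightarrow> emb b * coeff Q r \<in> range emb"
      by (rule common_denominator[of "{Suc n<..degree Q}" "coeff Q"]) (use rat in auto)
    have b': "emb b * coeff Q r \<in> range emb" if "r > Suc n" for r
    proof (cases "r \<le> degree Q")
      case False
      then show ?thesis using emb_0 by (simp add: coeff_eq_0)
    qed (use b that in auto)
    have f_diff: "f (u + h) * cnj (f u) = \<psi> (poly (\<Delta> h) (emb u))" if "b dvd h" for u h
      unfolding f_def \<Delta>_def by (rule \<psi>_difference[OF b' that])
    have "(\<lambda>N. avg (F N) f) \<longlonglongrightarrow> 0"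
    proof (cases "n = 0")
      case True
      \<comment> \<open>Here differences have constant phase: a suitable shift multiplies
        \<open>f\<close> by a fixed \<open>c \<noteq> 1\<close>, yet changes the averages only by a
        null sequence, so they tend to 0.\<close>
      define a where "a = coeff Q 1"
      have "\<not> rational_fls (a * emb b)"
        using irr b(1) by (simp add: a_def True rational_fls_mult_emb_iff)
      then have "a * emb b \<notin> range emb" by auto
      then obtain w where w: "\<psi> (a * emb b * emb w) \<noteq> 1" by (rule \<psi>_nontrivial_on_multiples)
      define c where "c = \<psi> (a * emb (b * w))"
      have "poly (\<Delta> (b * w)) (emb u) = a * emb (b * w)" for u
        by (simp add: \<Delta>_def True poly_truncated_difference a_def)
      then have "f (u + b * w) * cnj (f u) = c" for u
        using f_diff[of "b * w" u] by (simp add: c_def)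
      moreover have "cnj (f u) * f u = 1" for u
        using complex_norm_square[of "f u"] by (simp add: f_def mult.commute)
      ultimately have "f (u + b * w) = c * f u" for u
        by (metis mult.assoc mult.right_neutral)
      then have "(\<lambda>N. (c - 1) * avg (F N) f) \<longlonglongrightarrow> 0"
        using folner_shift[OF F, of f "b * w"]
        by (simp add: norm_f avg_mult_left algebra_simps del: emb_add)
      then have "(\<lambda>N. 1 / (c - 1) * ((c - 1) * avg (F N) f)) \<longlonglongrightarrow> 0"
        by (rule tendsto_mult_right_zero)
      then show ?thesis using w by (simp add: c_def mult.assoc)
    next
      case False
      \<comment> \<open>The largest possible exponent \<open>n\<close> of a difference is reduced to
        \<open>s\<close>, where an irrational coefficient will be found.\<close>
      obtain s where s: "n = p ^ multiplicity p n * s" "\<not> p dvd s"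
        by (rule multiplicity_decompose'[of n p]) (use False p in auto)
      define v where "v = multiplicity p n"
      have n: "n = CHAR('a) ^ v * s" using s by (simp add: v_def p_def)
      have "s > 0" using s(2) by (rule contrapos_np) auto
      \<comment> \<open>\<open>CHAR('a)\<close> does not divide \<open>Suc n\<close>, so this factor
        from the binomial expansion is a nonzero constant and preserves irrationality.\<close>
      have "of_nat (Suc n) \<noteq> (0 :: 'a poly)"
        unfolding of_nat_eq_0_iff_char_dvd using \<open>\<not> (_ \<or> _)\<close> by simp
      then have "\<not> rational_fls (coeff Q (Suc n) * emb (of_nat (Suc n) * b))"
        using irr b(1) by (subst rational_fls_mult_emb_iff) auto
      then obtain w where
        "\<not> rational_fls (cartier_iter v (coeff Q (Suc n) * emb (of_nat (Suc n) * b) * emb w))"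
        using cartier_iter_irrational by blast
      then have w: "\<not> rational_fls (cartier_iter v (of_nat (Suc n) * coeff Q (Suc n) * emb (b * w)))"
        by (simp add: mult_ac)
      define h where "h y = b * w * y ^ (CHAR('a) ^ v)" for y
      obtain G where G: "\<And>y. reduced_coeff (\<Delta> (h y)) s = poly G (emb y)"
        "coeff G 1 = cartier_iter v (of_nat (Suc n) * coeff Q (Suc n) * emb (b * w))"
        using reduced_coeff_truncated_difference[OF \<open>s > 0\<close>, of v Q "b * w"]
        unfolding n[symmetric] \<Delta>_def h_def by blast
      have "finite {y. rational_fls (poly G (emb y))}"
        by (rule irrational_coeff_imp_finite_rational_values[of G 1]) (use w G in simp)
      then obtain y :: "nat \<Rightarrow> 'a poly" where
        y: "\<And>i j. i \<noteq> j \<Longrightarrow> y i - y j \<notin> {y. rational_fls (poly G (emb y))}"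
        using avoiding_differences by blast
      \<comment> \<open>The \<open>p^v\<close>-th power makes \<open>h\<close> additive, so
        \<open>h (y i) - h (y j)\<close> is the shift at \<open>y i - y j\<close>, which is not a
        bad argument.\<close>
      have h_diff: "h x - h y = h (x - y)" for x y
        using freshmans_dream'[of "CHAR('a) ^ v" v "x - y" y]
        by (simp add: h_def prime_CHAR_finite_field algebra_simps)
      show ?thesis
      proof (rule van_der_corput[OF F, where h = "\<lambda>i. h (y i)"])
        fix i j :: nat assume "i \<noteq> j"
        then have "\<not> rational_fls (reduced_coeff (\<Delta> (h (y i - y j))) s)"
          using y G(1) by simp
        moreover have "rational_fls (reduced_coeff (\<Delta> (h (y i - y j))) r)" if "r > n" for r
          using degree_truncated_difference[of n Q] that
          by (subst reduced_coeff_eq_0) (auto simp: \<Delta>_def intro: le_less_trans)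
        ultimately have "(\<lambda>N. avg (F N) (\<lambda>u. \<psi> (poly (\<Delta> (h (y i - y j))) (emb u)))) \<longlonglongrightarrow> 0"
          using s(2) by (intro Suc.IH) (auto simp: p_def)
        then show "(\<lambda>N. avg (F N) (\<lambda>u. f (u + (h (y i) - h (y j))) * cnj (f u))) \<longlonglongrightarrow> 0"
          by (subst h_diff, subst f_diff) (auto simp: h_def)
      qed (rule norm_f)
    qed
    then show ?thesis
      unfolding f_def Q_def by (rule avg_reduce_tendsto_0)
  qed
qed

lemma weyl_sums_tendsto_0:
  assumes "folner F" "\<not> CHAR('a) dvd r" "\<not> rational_fls (reduced_coeff P r)"
  shows "(\<lambda>N. avg (F N) (\<lambda>u. \<psi> (poly P (emb u)))) \<longlonglongrightarrow> 0"
  by (rule weyl_sums_tendsto_0_induct[of F "degree P"])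
    (use assms in \<open>auto simp: reduced_coeff_eq_0\<close>)

end

subsection \<open>Equidistribution\<close>

definition laurent_of_fls :: "'a::zero fls \<Rightarrow> int \<Rightarrow> 'a" where
  "laurent_of_fls f n = fls_nth f (- n)"

lemma laurent_of_fls_eq_iff: "laurent_of_fls f = laurent_of_fls g \<longleftrightarrow> f = g"
  by (metis fls_eqI laurent_of_fls_def minus_minus)

lemma laurentE:
  assumes "laurent c"
  obtains f where "c = laurent_of_fls f"
proof -
  obtain N where "\<forall>n>N. c n = 0" using assms by (auto simp: laurent_def)
  then have "\<exists>M. \<forall>n<M. c (- n) = 0" by (intro exI[of _ "- N"]) auto
  from nth_Abs_fls_ex_lower_bound[OF this] have "c = laurent_of_fls (Abs_fls (\<lambda>n. c (- n)))"
    by (simp add: laurent_of_fls_def fun_eq_iff)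
  then show thesis by (rule that)
qed

text \<open>After reflecting the index both sides are the same Cauchy sum: the support used by
  \<open>lmul\<close> lies in the interval given by the subdegrees, and the other terms there
  vanish.\<close>

lemma lmul_laurent_of_fls: "lmul (laurent_of_fls f) (laurent_of_fls g) = laurent_of_fls (f * g)"
proof
  fix n
  define I where "I = {i. laurent_of_fls f i \<noteq> 0 \<and> laurent_of_fls g (n - i) \<noteq> 0}"
  have "(\<Sum>i\<in>I. laurent_of_fls f i * laurent_of_fls g (n - i)) =
      (\<Sum>j\<in>uminus ` I. fls_nth f j * fls_nth g (- n - j))"
    by (subst sum.reindex) (auto simp: laurent_of_fls_def algebra_simps)
  also have "\<dots> = (\<Sum>j = fls_subdegree f..- n - fls_subdegree g. fls_nth f j * fls_nth g (- n - j))"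
  proof (rule sum.mono_neutral_left)
    show "uminus ` I \<subseteq> {fls_subdegree f..- n - fls_subdegree g}"
    proof clarify
      fix i assume "i \<in> I"
      then have "fls_nth f (- i) \<noteq> 0" "fls_nth g (i - n) \<noteq> 0"
        by (auto simp: I_def laurent_of_fls_def)
      then show "- i \<in> {fls_subdegree f..- n - fls_subdegree g}"
        using fls_subdegree_leI[of f "- i"] fls_subdegree_leI[of g "i - n"] by auto
    qed
    show "\<forall>j\<in>{fls_subdegree f..- n - fls_subdegree g} - uminus ` I. fls_nth f j * fls_nth g (- n - j) = 0"
    proof
      fix j assume "j \<in> {fls_subdegree f..- n - fls_subdegree g} - uminus ` I"
      then have "- j \<notin> I" by (metis DiffD2 image_eqI minus_minus)
      then show "fls_nth f j * fls_nth g (- n - j) = 0"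
        using minus_diff_commute[of j n] by (auto simp: I_def laurent_of_fls_def)
    qed
  qed simp
  also have "\<dots> = fls_nth (f * g) (- n)"
    by (simp add: fls_times_nth(2))
  finally show "lmul (laurent_of_fls f) (laurent_of_fls g) n = laurent_of_fls (f * g) n"
    by (simp add: lmul_def I_def laurent_of_fls_def)
qed

lemma poly_to_R_eq: "poly_to_R u = laurent_of_fls (emb u)"
  by (auto simp: poly_to_R_def laurent_of_fls_def)

lemma lpow_laurent_of_fls: "lpow (laurent_of_fls f) m = laurent_of_fls (f ^ m)"
proof (induction m)
  case 0
  show ?case by (auto simp: lone_def laurent_of_fls_def)
qed (simp add: lmul_laurent_of_fls)

lemma in_Q_laurent_of_fls: "rational_fls f \<Longrightarrow> in_Q (laurent_of_fls f)"
  unfolding in_Q_def rational_fls_def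
  by (auto simp: poly_to_R_eq lmul_laurent_of_fls laurent_of_fls_eq_iff image_iff)

lemma evalP_eq:
  assumes "\<And>r. r \<in> K \<union> {0} \<Longrightarrow> \<alpha> r = laurent_of_fls (f r)"
  shows "evalP K \<alpha> u n = fls_nth (poly (\<Sum>r\<in>K \<union> {0}. monom (f r) r) (emb u)) (- n)"
  unfolding evalP_def poly_sum poly_monom fls_nth_sum
  by (intro sum.cong refl)
    (simp add: assms poly_to_R_eq lpow_laurent_of_fls lmul_laurent_of_fls laurent_of_fls_def)

section \<open>Fourier expansion of cylinder sets and Weyl's criterion\<close>

context frobenius_character
begin

text \<open>Orthogonality detects each equality \<open>c j = a j\<close>; expanding the product over
  \<open>j\<close> gives one character per frequency \<open>g\<close>.\<close>

lemma indicator_eq_character_sum: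
  "of_bool (\<forall>j\<in>{1..M}. c j = a j) =
     (\<Sum>g\<in>{1..M} \<rightarrow>\<^sub>E UNIV. \<kappa> (- (\<Sum>j=1..M. g j * a j)) * \<kappa> (\<Sum>j=1..M. g j * c j)) / of_nat CARD('a) ^ M"
  for c :: "nat \<Rightarrow> 'a"
proof -
  have "(\<Prod>j=1..M. \<Sum>x\<in>UNIV. \<kappa> (x * (c j - a j))) =
      (\<Sum>g\<in>{1..M} \<rightarrow>\<^sub>E UNIV. \<Prod>j=1..M. \<kappa> (g j * (c j - a j)))"
    by (rule prod_sum_PiE) auto
  also have "\<dots> = (\<Sum>g\<in>{1..M} \<rightarrow>\<^sub>E UNIV. \<kappa> (- (\<Sum>j=1..M. g j * a j)) * \<kappa> (\<Sum>j=1..M. g j * c j))"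
    by (simp flip: \<kappa>_sum \<kappa>_add add: right_diff_distrib sum_subtractf)
  also have "(\<Prod>j=1..M. \<Sum>x\<in>UNIV. \<kappa> (x * (c j - a j))) =
      (\<Prod>j=1..M. if c j = a j then of_nat CARD('a) else 0)"
    by (simp add: sum_\<kappa>_mult)
  also have "\<dots> = of_nat CARD('a) ^ M * of_bool (\<forall>j\<in>{1..M}. c j = a j)"
    by (auto simp: prod_zero_iff)
  finally show ?thesis by (simp add: field_simps)
qed

text \<open>Weyl's criterion: the zero frequency gives the main term, and every other frequency is a
  nonzero multiplier \<open>m\<close>, whose averages vanish in the limit.\<close>

lemma unif_distributed_criterion:
  assumes F: "folner F"
    and s: "\<And>u n. s u n = fls_nth (S u) (- n)"
    and weyl: "\<And>m. m \<noteq> 0 \<Longrightarrow> (\<lambda>N. avg (F N) (\<lambda>u. \<psi> (emb m * S u))) \<longlonglongrightarrow> 0"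
  shows "unif_distributed s F"
  unfolding unif_distributed_def
proof (intro allI impI)
  fix M :: nat and a :: "nat \<Rightarrow> 'a"
  define q where "q = CARD('a)"
  have q: "q > 0" by (simp add: q_def)
  define PE where "PE = {1..M} \<rightarrow>\<^sub>E (UNIV :: 'a set)"
  have fin: "finite PE" unfolding PE_def by (intro finite_PiE) auto
  define w where "w g = \<kappa> (- (\<Sum>j=1..M. g j * a j))" for g
  \<comment> \<open>Multiplication by \<open>t^(j-1)\<close> moves the coefficient of
    \<open>t^-j\<close> to \<open>t^-1\<close>, so the character of frequency \<open>g\<close> is
    \<psi> after multiplication by \<open>m g\<close>.\<close>
  define m where "m g = (\<Sum>j=1..M. monom (g j) (j - 1))" for g :: "nat \<Rightarrow> 'a"
  \<comment> \<open>The zero frequency, restricted to \<open>{1..M}\<close> so that it is an element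
    of \<open>PE\<close>.\<close>
  define g0 where "g0 = (\<lambda>j\<in>{1..M}. 0 :: 'a)"
  have g0: "g0 \<in> PE" by (auto simp: g0_def PE_def)
  have m0: "m g0 = 0" by (simp add: m_def g0_def)
  have mnz: "m g \<noteq> 0" if g: "g \<in> PE" "g \<noteq> g0" for g
  proof -
    obtain j where j: "g j \<noteq> g0 j" using g(2) by blast
    then have "j \<in> {1..M}" "g j \<noteq> 0"
      using g(1) by (auto simp: PE_def g0_def PiE_def extensional_def restrict_def split: if_splits)
    then have "coeff (m g) (j - 1) = (\<Sum>i=1..M. if i = j then g j else 0)"
      unfolding m_def coeff_sum coeff_monom by (intro sum.cong) auto
    then have "coeff (m g) (j - 1) = g j" using \<open>j \<in> {1..M}\<close> by simp
    with \<open>g j \<noteq> 0\<close> show ?thesis by auto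
  qed
  define A where "A g N = avg (F N) (\<lambda>u. \<psi> (emb (m g) * S u))" for g N
  have A0: "A g0 N = 1" for N
    using folner_card_pos[OF F, of N] by (simp add: A_def m0 avg_def)
  have lim: "A g \<longlonglongrightarrow> of_bool (g = g0)" if "g \<in> PE" for g
    using weyl[OF mnz[OF that]] A0 by (cases "g = g0") (auto simp: A_def[abs_def])
  have ind: "of_bool (in_cylinder (s u) M a) =
      (1 / of_nat q ^ M) * (\<Sum>g\<in>PE. w g * \<psi> (emb (m g) * S u))" for u
  proof -
    have "\<psi> (emb (m g) * S u) = \<kappa> (\<Sum>j=1..M. g j * fls_nth (S u) (int j))" for g
      unfolding \<psi>_def m_def emb_sum sum_distrib_right fls_nth_sum fls_nth_emb_monom_mult
      by (intro arg_cong[of _ _ \<kappa>] sum.cong) auto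
    then show ?thesis
      using indicator_eq_character_sum[of M "\<lambda>j. fls_nth (S u) (int j)" a]
      by (simp add: in_cylinder_def s w_def PE_def q_def)
  qed
  have card_eq: "complex_of_real (real (card {u \<in> F N. in_cylinder (s u) M a}) / real (card (F N))) =
      (1 / of_nat q ^ M) * (\<Sum>g\<in>PE. w g * A g N)" for N
  proof -
    have "of_nat (card {u \<in> F N. in_cylinder (s u) M a}) = (\<Sum>u\<in>F N. of_bool (in_cylinder (s u) M a) :: complex)"
      using F by (simp add: sum.If_cases of_bool_def Int_def)
    then have "complex_of_real (real (card {u \<in> F N. in_cylinder (s u) M a}) / real (card (F N))) =
        avg (F N) (\<lambda>u. of_bool (in_cylinder (s u) M a))"
      by (simp add: avg_def)
    also have "\<dots> = (1 / of_nat q ^ M) * (\<Sum>g\<in>PE. w g * A g N)"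
      unfolding ind avg_mult_left avg_sum A_def ..
    finally show ?thesis .
  qed
  have "(\<lambda>N. (1 / of_nat q ^ M) * (\<Sum>g\<in>PE. w g * A g N)) \<longlonglongrightarrow>
      (1 / of_nat q ^ M) * (\<Sum>g\<in>PE. w g * of_bool (g = g0))"
    by (intro tendsto_intros lim)
  also have "(\<Sum>g\<in>PE. w g * of_bool (g = g0)) = (\<Sum>g\<in>PE. if g = g0 then w g else 0)"
    by (intro sum.cong) auto
  also have "\<dots> = 1"
    using fin g0 by (simp add: w_def g0_def)
  finally have "(\<lambda>N. complex_of_real (real (card {u \<in> F N. in_cylinder (s u) M a}) / real (card (F N))))
      \<longlonglongrightarrow> complex_of_real (1 / real q ^ M)"
    unfolding card_eq by simp
  then show "(\<lambda>N. real (card {u \<in> F N. in_cylinder (s u) M a}) / real (card (F N)))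
      \<longlonglongrightarrow> 1 / real CARD('a) ^ M"
    unfolding tendsto_of_real_iff q_def .
qed

end

theorem theorem1p2:
  fixes K :: "nat set" and \<alpha> :: "nat \<Rightarrow> int \<Rightarrow> 'a::{field,finite}" and k :: nat
  assumes "finite K" and "0 \<notin> K"
    and "\<forall>r\<in>K \<union> {0}. laurent (\<alpha> r)"
    and "k \<in> K"
    and "\<not> CHAR('a) dvd k"
    and "\<forall>v::nat. v > 0 \<longrightarrow> CHAR('a) ^ v * k \<notin> K"
    and "\<not> in_Q (\<alpha> k)"
  shows "well_distributed (evalP K \<alpha>)"
  unfolding well_distributed_def
proof (intro allI impI)
  fix F :: "nat \<Rightarrow> 'a poly set" assume F: "folner F"
  obtain \<kappa> :: "'a \<Rightarrow> complex" where "frobenius_character \<kappa>"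
    using frobenius_character_exists by blast
  then interpret frobenius_character \<kappa> .
  have "\<forall>r\<in>K \<union> {0}. \<exists>f. \<alpha> r = laurent_of_fls f"
    using assms(3) laurentE by metis
  then obtain f where f: "\<And>r. r \<in> K \<union> {0} \<Longrightarrow> \<alpha> r = laurent_of_fls (f r)"
    by (auto simp: bchoice_iff)
  define P where "P = (\<Sum>r\<in>K \<union> {0}. monom (f r) r)"
  have coeff_P: "coeff P r = (if r \<in> K \<union> {0} then f r else 0)" for r
    using assms(1) by (simp add: P_def coeff_sum)
  show "unif_distributed (evalP K \<alpha>) F"
  proof (rule unif_distributed_criterion[OF F, where S = "\<lambda>u. poly P (emb u)"])
    show "evalP K \<alpha> u n = fls_nth (poly P (emb u)) (- n)" for u n
      unfolding P_def using f by (rule evalP_eq)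
  next
    fix m :: "'a poly" assume m: "m \<noteq> 0"
    define P' where "P' = smult (emb m) P"
    have k: "k > 0" using assms(5) by (cases k) auto
    \<comment> \<open>For \<open>i > 0\<close> the exponent lies outside \<open>K\<close> by
      assumption and is not 0 either, so nothing is added to the coefficient at
      \<open>k\<close>.\<close>
    have "coeff P' (CHAR('a) ^ i * k) = (if i = 0 then emb m * f k else 0)" for i
      using assms(4,6) k prime_gt_0_nat[OF prime_CHAR_finite_field[where ?'a = 'a]]
      by (simp add: P'_def coeff_P)
    then have "reduced_coeff P' k = (\<Sum>i\<le>degree P'. if i = 0 then emb m * f k else 0)"
      unfolding reduced_coeff_def by (intro sum.cong refl) simp
    then have "reduced_coeff P' k = f k * emb m"
      by (simp add: mult.commute)
    moreover have "\<not> rational_fls (f k)"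
      using f[of k] assms(4,7) in_Q_laurent_of_fls by auto
    ultimately have "\<not> rational_fls (reduced_coeff P' k)"
      using m by (simp add: rational_fls_mult_emb_iff)
    then have "(\<lambda>N. avg (F N) (\<lambda>u. \<psi> (poly P' (emb u)))) \<longlonglongrightarrow> 0"
      by (rule weyl_sums_tendsto_0[OF F assms(5)])
    then show "(\<lambda>N. avg (F N) (\<lambda>u. \<psi> (emb m * poly P (emb u)))) \<longlonglongrightarrow> 0"
      by (simp add: P'_def)
  qed
qed

end
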